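(* Let $\theta\in\mathbb{N}$, $N\in\mathbb{N}$, $\lambda\in\mathbb{GT}_N$ and $x\in\mathbb{C}\setminus\{0,1\}$. Then $$J_\lambda(x;N,\theta)=\frac{(\theta N-1)!}{(x-1)^{\theta N-1}}\,\frac1{2\pi\mathbf{i}}\oint_{\mathcal{C}_0}\frac{x^z}{\prod_{i=1}^N\prod_{j=0}^{\theta-1}\left(z-(\lambda_i+\theta(N-i)+j)\right)}\,dz,$$ where $\mathcal{C}_0$ is a closed positively oriented contour enclosing all the poles $\{\lambda_i+\theta(N-i)+j:\ i=1,\dots,N,\ j=0,1,\dots,\theta-1\}$.
   Context: $\mathbb{N}=\{1,2,\dots\}$ and $\mathbf{i}=\sqrt{-1}$. $\mathbb{GT}_N$ is the set of signatures of length $N$, i.e. integer sequences $\lambda=(\lambda_1\ge\dots\ge\lambda_N)$; $\mathbb{GT}^+_N$ is the subset with $\lambda_N\ge 0$; $|\lambda|=\sum_i\lambda_i$. Jack polynomials: for $\theta>0$ and $\lambda\in\mathbb{GT}_N^+$, $J_\lambda(x_1,\dots,x_N;\theta)$ is the Jack symmetric polynomial with Jack parameter $\alpha=1/\theta$, normalized so that the coefficient of $x_1^{\lambda_1}\cdots x_N^{\lambda_N}$ is $1$ (the limit $q\to1$, $t=q^\theta$, of Macdonald polynomials $P_\lambda(\cdot;q,t)$). Explicitly it is determined by $J_{(\lambda_1)}(x_1;\theta)=x_1^{\lambda_1}$ and the branching rule $J_\lambda(x_1,\dots,x_{N+1};\theta)=\sum_{\mu\prec\lambda}\psi_{\lambda/\mu}(\theta)\,x_{N+1}^{|\lambda|-|\mu|}J_\mu(x_1,\dots,x_N;\theta)$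 for $\lambda\in\mathbb{GT}^+_{N+1}$, where the sum is over $\mu\in\mathbb{GT}^+_N$ with $\lambda_{N+1}\le\mu_N\le\lambda_N\le\dots\le\mu_1\le\lambda_1$, and, with $(a)_n=a(a+1)\cdots(a+n-1)$, $$\psi_{\lambda/\mu}(\theta)=\prod_{1\le i\le j\le N}\frac{(\mu_i-\mu_j+\theta(j-i)+\theta)_{\mu_j-\lambda_{j+1}}}{(\mu_i-\mu_j+\theta(j-i)+1)_{\mu_j-\lambda_{j+1}}}\cdot\frac{(\lambda_i-\mu_j+\theta(j-i)+1)_{\mu_j-\lambda_{j+1}}}{(\lambda_i-\mu_j+\theta(j-i)+\theta)_{\mu_j-\lambda_{j+1}}}.$$ For general $\lambda\in\mathbb{GT}_N$, $J_\lambda(x_1,\dots,x_N;\theta)=(x_1\cdots x_N)^{-K}J_{(\lambda_1+K,\dots,\lambda_N+K)}(x_1,\dots,x_N;\theta)$ for any integer $K\ge0$ with $\lambda_N+K\ge0$ (independent of $K$). Jack characters: for $1\le m\le N$ and $\lambda\in\mathbb{GT}_N$, $J_\lambda(x_1,\dots,x_m;N,\theta)=J_\lambda(x_1,\dots,x_m,1^{N-m};\theta)/J_\lambda(1^N;\theta)$, where $1^k$ is a string of $k$ ones (the denominator is nonzero). Branches: $x^z=\exp(z\ln x)$ with the principal logarithm if $x\notin(-\infty,0)$, and with $\operatorname{Im}\ln x=\pi$ if $x\in(-\infty,0)$. *)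

theory Defs
  imports "HOL-Complex_Analysis.Complex_Analysis"
begin

text \<open>Signatures of length \<open>N\<close> are functions on \<open>{1..N}\<close>, extended by \<open>undefined\<close> outside, so that
  each integer sequence has exactly one representative.\<close>

definition signatures :: "nat \<Rightarrow> (nat \<Rightarrow> int) set" where
  "signatures N = {lam \<in> extensional {1..N}. \<forall>i\<in>{1..N}. \<forall>j\<in>{1..N}. i \<le> j \<longrightarrow> lam j \<le> lam i}"

definition signatures_nonneg :: "nat \<Rightarrow> (nat \<Rightarrow> int) set" where
  "signatures_nonneg N = {lam \<in> signatures N. 0 \<le> lam N}"

definition sig_size :: "nat \<Rightarrow> (nat \<Rightarrow> int) \<Rightarrow> int" where
  "sig_size N lam = (\<Sum>i=1..N. lam i)"

text \<open>Here \<open>lam\<close> has length \<open>N + 1\<close> and \<open>mu\<close> has length \<open>N\<close>.\<close>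

definition interlaces :: "nat \<Rightarrow> (nat \<Rightarrow> int) \<Rightarrow> (nat \<Rightarrow> int) \<Rightarrow> bool" where
  "interlaces N mu lam \<longleftrightarrow> (\<forall>i\<in>{1..N}. lam (i + 1) \<le> mu i \<and> mu i \<le> lam i)"

definition jack_psi :: "real \<Rightarrow> nat \<Rightarrow> (nat \<Rightarrow> int) \<Rightarrow> (nat \<Rightarrow> int) \<Rightarrow> real" where
  "jack_psi \<theta> N lam mu =
     (\<Prod>i=1..N. \<Prod>j=i..N.
        (let n = nat (mu j - lam (j + 1)) in
          pochhammer (of_int (mu i - mu j) + \<theta> * real (j - i) + \<theta>) n
        / pochhammer (of_int (mu i - mu j) + \<theta> * real (j - i) + 1) n
        * (pochhammer (of_int (lam i - mu j) + \<theta> * real (j - i) + 1) n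
         / pochhammer (of_int (lam i - mu j) + \<theta> * real (j - i) + \<theta>) n)))"

text \<open>Value of the Jack polynomial of \<open>lam \<in> signatures_nonneg N\<close> at the point \<open>(x 1, \<dots>, x N)\<close>, by the
  branching rule; the case \<open>N = 0\<close> is a dummy. The exponent of the last variable is nonnegative
  because the two signatures interlace.\<close>

fun jack_nonneg :: "real \<Rightarrow> nat \<Rightarrow> (nat \<Rightarrow> int) \<Rightarrow> (nat \<Rightarrow> complex) \<Rightarrow> complex" where
  "jack_nonneg \<theta> 0 lam x = 1"
| "jack_nonneg \<theta> (Suc 0) lam x = x 1 ^ nat (lam 1)"
| "jack_nonneg \<theta> (Suc (Suc n)) lam x =
     (\<Sum>mu\<in>{mu \<in> signatures_nonneg (Suc n). interlaces (Suc n) mu lam}.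
        complex_of_real (jack_psi \<theta> (Suc n) lam mu)
        * x (Suc (Suc n)) ^ nat (sig_size (Suc (Suc n)) lam - sig_size (Suc n) mu)
        * jack_nonneg \<theta> (Suc n) mu x)"

text \<open>For arbitrary signatures the value does not depend on the shift \<open>K \<ge> 0\<close> with
  \<open>lam N + K \<ge> 0\<close>; we take the least one.\<close>

definition jack :: "real \<Rightarrow> nat \<Rightarrow> (nat \<Rightarrow> int) \<Rightarrow> (nat \<Rightarrow> complex) \<Rightarrow> complex" where
  "jack \<theta> N lam x =
     (let K = max 0 (- lam N) in
        (\<Prod>i=1..N. x i) powi (- K) * jack_nonneg \<theta> N (\<lambda>i\<in>{1..N}. lam i + K) x)"

text \<open>The Jack character \<open>J\<^sub>\<lambda>(x\<^sub>1, \<dots>, x\<^sub>m; N, \<theta>)\<close>, for \<open>1 \<le> m \<le> N\<close>.\<close>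

definition jack_char :: "real \<Rightarrow> nat \<Rightarrow> nat \<Rightarrow> (nat \<Rightarrow> int) \<Rightarrow> (nat \<Rightarrow> complex) \<Rightarrow> complex" where
  "jack_char \<theta> N m lam x =
     jack \<theta> N lam (\<lambda>i. if i \<le> m then x i else 1) / jack \<theta> N lam (\<lambda>_. 1)"

definition jack_pole :: "nat \<Rightarrow> nat \<Rightarrow> (nat \<Rightarrow> int) \<Rightarrow> nat \<Rightarrow> nat \<Rightarrow> complex" where
  "jack_pole \<theta> N lam i j = of_int (lam i + int (\<theta> * (N - i) + j))"

end

theory Submission imports Defs begin

text \<open>Put \<open>\<theta> = k + 1\<close> and \<open>l\<^sub>i = \<lambda>\<^sub>i + \<theta>(N - i)\<close>, so that the poles form the blocks \<open>{l\<^sub>i, ..., l\<^sub>i + k}\<close>. By residues, the contour integral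
is the divided difference of \<open>p \<mapsto> x\<^sup>p\<close> over the poles. That \<open>(x - 1)\<^bsup>\<theta>N - 1\<^esup> J\<^sub>\<lambda>(x, 1, ..., 1)\<close> is \<open>(\<theta>N - 1)! J\<^sub>\<lambda>(1, ..., 1)\<close> times this
divided difference is shown by induction on \<open>N\<close> along the branching rule. For integral \<open>\<theta>\<close>, the branching coefficient
times \<open>J\<^sub>\<mu>(1, ..., 1)\<close> is, up to a factor independent of \<open>\<mu>\<close>, the Vandermonde product of \<open>m\<^sub>i = \<mu>\<^sub>i + \<theta>(N - i)\<close> times \<open>\<Prod> P(m\<^sub>i)\<close>
for a polynomial \<open>P\<close> that vanishes at the \<open>k\<close> integers below each \<open>l\<^sub>i\<close> (a discrete Dixon-Anderson density).

The core is the following identity: averaging, with these weights, the divided difference of \<open>\<Delta>\<^sup>\<theta> f\<close> over the blocks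
at \<open>m\<^sub>1, ..., m\<^sub>N\<close> gives a multiple of the divided difference of \<open>f\<close> over the blocks at \<open>l\<^sub>1, ..., l\<^bsub>N+1\<^esub>\<close>. The coefficient of
\<open>(\<Delta>\<^sup>\<theta> f)(q)\<close> for \<open>l\<^bsub>i+1\<^esub> \<le> q < l\<^sub>i\<close> is a rational function of \<open>q\<close> whose polar parts cancel by antisymmetry of the weights, hence
a polynomial of degree less than \<open>\<theta>\<close>. By summation by parts the average depends only on the values of \<open>f\<close> at the
blocks of \<open>l\<close>, and polynomials \<open>f\<close> of degree less than \<open>\<theta>(N + 1)\<close> determine it. The indicator function of \<open>l\<^bsub>N+1\<^esub>\<close> then gives
a recursion for the total weight, which closes the induction.\<close>

section \<open>Divided differences and finite differences\<close>

definition divided_diff :: "int set \<Rightarrow> (int \<Rightarrow> complex) \<Rightarrow> complex" where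
  "divided_diff S f = (\<Sum>p\<in>S. f p / (\<Prod>s\<in>S - {p}. of_int (p - s)))"

definition root_poly :: "int set \<Rightarrow> complex poly" where
  "root_poly S = (\<Prod>s\<in>S. [:- of_int s, 1:])"

lemma poly_root_poly: "poly (root_poly S) z = (\<Prod>s\<in>S. z - of_int s)"
  by (simp add: root_poly_def poly_prod)

lemma root_poly_nonzero [simp]: "root_poly S \<noteq> 0"
  by (cases "finite S") (simp_all add: root_poly_def prod_zero_iff)

lemma degree_root_poly [simp]: "degree (root_poly S) = card S"
  by (cases "finite S") (simp_all add: root_poly_def degree_prod_eq_sum_degree)

lemma lead_coeff_root_poly: "coeff (root_poly S) (card S) = 1"
proof -
  have "lead_coeff (root_poly S) = 1"
    by (simp add: root_poly_def lead_coeff_prod)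
  then show ?thesis by simp
qed

definition lagrange_poly :: "int set \<Rightarrow> (int \<Rightarrow> complex) \<Rightarrow> complex poly" where
  "lagrange_poly S f = (\<Sum>s\<in>S. smult (f s / (\<Prod>t\<in>S - {s}. of_int (s - t))) (root_poly (S - {s})))"

lemma degree_lagrange_poly:
  assumes "finite S" "S \<noteq> {}"
  shows "degree (lagrange_poly S f) < card S"
proof -
  have "degree (lagrange_poly S f) \<le> card S - 1"
    unfolding lagrange_poly_def
    by (rule degree_sum_le) (use assms in \<open>auto intro!: order.trans[OF degree_smult_le]\<close>)
  moreover have "card S > 0" using assms by (simp add: card_gt_0_iff)
  ultimately show ?thesis by linarith
qed

lemma poly_lagrange_poly:
  assumes fin: "finite S" and u: "u \<in> S"
  shows "poly (lagrange_poly S f) (of_int u) = f u"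
proof -
  have "poly (lagrange_poly S f) (of_int u) = (\<Sum>s\<in>S. if s = u then f u else 0)"
    unfolding lagrange_poly_def poly_sum
  proof (rule sum.cong, simp)
    fix s assume s: "s \<in> S"
    show "poly (smult (f s / (\<Prod>t\<in>S - {s}. of_int (s - t))) (root_poly (S - {s}))) (of_int u)
        = (if s = u then f u else 0)"
    proof (cases "s = u")
      case True
      have "(\<Prod>t\<in>S - {s}. of_int (s - t) :: complex) \<noteq> 0"
        using fin by auto
      with True show ?thesis
        by (simp add: poly_root_poly)
    next
      case False
      then have "(\<Prod>t\<in>S - {s}. (of_int u - of_int t :: complex)) = 0"
        using fin u by auto
      with False show ?thesis by (simp add: poly_root_poly)
    qed
  qed
  also have "\<dots> = f u" using fin u by simp
  finally show ?thesis .
qed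

lemma lagrange_interpolation:
  assumes fin: "finite S" and deg: "degree p < card S"
  shows "p = lagrange_poly S (\<lambda>s. poly p (of_int s))"
proof (rule poly_eqI_degree[where A = "of_int ` S"])
  have inj: "inj_on (of_int :: int \<Rightarrow> complex) S"
    by (simp add: inj_on_def)
  then show "card ((of_int :: int \<Rightarrow> complex) ` S) > degree p"
    using deg by (simp add: card_image)
  have "S \<noteq> {}" using deg by auto
  then show "card ((of_int :: int \<Rightarrow> complex) ` S) > degree (lagrange_poly S (\<lambda>s. poly p (of_int s)))"
    using degree_lagrange_poly[OF fin] inj by (simp add: card_image)
qed (auto simp: poly_lagrange_poly[OF fin])

text \<open>Each \<open>root_poly (S - {s})\<close> is monic of degree \<open>card S - 1\<close>, so
  comparing top coefficients in the Lagrange formula produces the divided difference.\<close>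

lemma divided_diff_poly:
  assumes "finite S" and "degree p < card S"
  shows "divided_diff S (\<lambda>a. poly p (of_int a)) = coeff p (card S - 1)"
proof -
  have "coeff p (card S - 1) = (\<Sum>s\<in>S. poly p (of_int s) / (\<Prod>t\<in>S - {s}. of_int (s - t))
          * coeff (root_poly (S - {s})) (card S - 1))"
    by (subst lagrange_interpolation[OF assms]) (simp add: lagrange_poly_def coeff_sum)
  also have "\<dots> = divided_diff S (\<lambda>a. poly p (of_int a))"
    unfolding divided_diff_def
  proof (rule sum.cong, simp)
    fix s assume "s \<in> S"
    then have "card S - 1 = card (S - {s})" using assms by simp
    then show "poly p (of_int s) / (\<Prod>t\<in>S - {s}. of_int (s - t)) * coeff (root_poly (S - {s})) (card S - 1)
      = poly p (of_int s) / (\<Prod>t\<in>S - {s}. of_int (s - t))"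
      by (simp add: lead_coeff_root_poly)
  qed
  finally show ?thesis by simp
qed

text \<open>Divide by \<open>root_poly S\<close> with remainder; the remainder equals its own
  Lagrange interpolant. The disjunction makes \<open>d = 0\<close> mean that there is no polynomial
  part, because the zero polynomial has degree 0 by convention. The averaging identity takes
  \<open>d = Suc k\<close>, the contour integral \<open>d = 0\<close>.\<close>

lemma partial_fractions:
  assumes fin: "finite S" and deg: "degree p < card S + d"
  obtains E where "E = 0 \<or> degree E < d"
    and "\<And>z. z \<notin> of_int ` S \<Longrightarrow>
          poly p z / poly (root_poly S) z = poly E z + divided_diff S (\<lambda>s. poly p (of_int s) / (z - of_int s))"
proof
  let ?M = "root_poly S"
  define E r where "E = p div ?M" and "r = p mod ?M"
  have pE: "p = E * ?M + r" by (simp add: E_def r_def)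
  have r: "r = 0 \<or> degree r < card S"
    using degree_mod_less[of ?M p] by (simp add: r_def)
  show "E = 0 \<or> degree E < d"
  proof (rule disjCI)
    assume E: "\<not> degree E < d"
    show "E = 0"
    proof (rule ccontr)
      assume "E \<noteq> 0"
      then have "degree (E * ?M) = degree E + card S"
        by (simp add: degree_mult_eq)
      moreover have "degree p = degree (E * ?M)" if "r \<noteq> 0"
        using r that calculation unfolding pE by (intro degree_add_eq_left) simp
      ultimately have "degree p = degree E + card S"
        using pE by (cases "r = 0") auto
      with E deg show False by simp
    qed
  qed
  fix z :: complex assume z: "z \<notin> of_int ` S"
  have Mz: "poly ?M z \<noteq> 0"
    using z fin by (auto simp: poly_root_poly)
  have rs: "poly r (of_int s) = poly p (of_int s)" if "s \<in> S" for s
  proof -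
    have "poly ?M (of_int s) = 0" using that fin by (auto simp: poly_root_poly)
    then show ?thesis unfolding pE by simp
  qed
  have "poly r z = (\<Sum>s\<in>S. poly r (of_int s) / (\<Prod>t\<in>S - {s}. of_int (s - t)) * poly (root_poly (S - {s})) z)"
  proof (cases "r = 0")
    case False
    then show ?thesis using r fin
      by (subst lagrange_interpolation[of S r]) (auto simp: lagrange_poly_def poly_sum)
  qed simp
  also have "\<dots> = (\<Sum>s\<in>S. poly p (of_int s) / (z - of_int s) / (\<Prod>t\<in>S - {s}. of_int (s - t)) * poly ?M z)"
  proof (rule sum.cong, simp)
    fix s assume s: "s \<in> S"
    have "poly ?M z = (z - of_int s) * poly (root_poly (S - {s})) z"
      unfolding poly_root_poly using fin s by (simp add: prod.remove)
    moreover have "z - of_int s \<noteq> 0" using s z by auto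
    ultimately show "poly r (of_int s) / (\<Prod>t\<in>S - {s}. of_int (s - t)) * poly (root_poly (S - {s})) z
      = poly p (of_int s) / (z - of_int s) / (\<Prod>t\<in>S - {s}. of_int (s - t)) * poly ?M z"
      using s by (simp add: rs)
  qed
  also have "\<dots> = divided_diff S (\<lambda>s. poly p (of_int s) / (z - of_int s)) * poly ?M z"
    by (simp add: divided_diff_def sum_distrib_right)
  finally have "poly r z / poly ?M z = divided_diff S (\<lambda>s. poly p (of_int s) / (z - of_int s))"
    using Mz by simp
  moreover have "poly p z / poly ?M z = poly E z + poly r z / poly ?M z"
    using Mz by (subst pE) (simp add: add_divide_distrib)
  ultimately show "poly p z / poly ?M z = poly E z + divided_diff S (\<lambda>s. poly p (of_int s) / (z - of_int s))"
    by simp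
qed

section \<open>Finite differences of functions and of polynomials\<close>

definition fdiff :: "(int \<Rightarrow> complex) \<Rightarrow> int \<Rightarrow> complex" where
  "fdiff f a = f (a + 1) - f a"

definition pdiff :: "complex poly \<Rightarrow> complex poly" where
  "pdiff p = pcompose p [:1, 1:] - p"

lemma poly_pdiff: "poly (pdiff p) z = poly p (z + 1) - poly p z"
  by (simp add: pdiff_def poly_pcompose add.commute)

lemma fdiff_poly: "fdiff (\<lambda>a. poly p (of_int a)) = (\<lambda>a. poly (pdiff p) (of_int a))"
  by (simp add: fun_eq_iff fdiff_def poly_pdiff)

lemma funpow_fdiff_poly: "(fdiff ^^ k) (\<lambda>a. poly p (of_int a)) = (\<lambda>a. poly ((pdiff ^^ k) p) (of_int a))"
  by (induction k) (simp_all add: fdiff_poly)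

text \<open>Discrete Leibniz rule for the factor X; it drives the induction over the
  coefficients.\<close>

lemma pdiff_pCons: "pdiff (pCons a p) = pCons 0 (pdiff p) + (p + pdiff p)"
  by (rule poly_eqI) (simp add: pdiff_def pcompose_pCons coeff_pCons split: nat.splits)

text \<open>A bound \<open>d\<close> in place of the exact degree allows iteration without asking
  whether the top coefficient vanishes. The last conjunct covers \<open>d = 0\<close>, where
  \<open>d - 1\<close> is truncated to 0.\<close>

lemma pdiff_degree:
  "degree p \<le> d \<Longrightarrow> degree (pdiff p) \<le> d - 1 \<and> coeff (pdiff p) (d - 1) = of_nat d * coeff p d
     \<and> (d = 0 \<longrightarrow> pdiff p = 0)"
proof (induction p arbitrary: d)
  case 0
  then show ?case by (simp add: pdiff_def)
next
  case (pCons a p)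
  show ?case
  proof (cases d)
    case 0
    with pCons.prems have "p = 0" by (auto split: if_splits)
    then show ?thesis using 0 by (simp add: pdiff_def)
  next
    case d: (Suc e)
    have p: "degree p \<le> e" using pCons.prems d by (auto split: if_splits)
    note IH = pCons.IH[OF p]
    have "degree (pCons 0 (pdiff p)) \<le> e"
      using IH by (cases e) auto
    then have deg: "degree (pdiff (pCons a p)) \<le> e"
      unfolding pdiff_pCons using IH p by (intro degree_add_le) auto
    have "coeff (pdiff p) e = 0"
      using IH by (cases e) (auto intro!: coeff_eq_0)
    then have "coeff (pdiff (pCons a p)) e = coeff (pCons 0 (pdiff p)) e + coeff p e"
      by (simp add: pdiff_pCons)
    also have "\<dots> = of_nat (Suc e) * coeff p e"
      using IH by (cases e) (simp_all add: algebra_simps)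
    finally show ?thesis using deg d by simp
  qed
qed

lemma funpow_pdiff_degree:
  assumes "degree p \<le> d" and "k \<le> d"
  shows "degree ((pdiff ^^ k) p) \<le> d - k \<and> coeff ((pdiff ^^ k) p) (d - k) * fact (d - k) = fact d * coeff p d"
  using assms(2)
proof (induction k)
  case 0
  then show ?case using assms by simp
next
  case (Suc k)
  then have IH: "degree ((pdiff ^^ k) p) \<le> d - k"
      "coeff ((pdiff ^^ k) p) (d - k) * fact (d - k) = fact d * coeff p d" by auto
  have dk: "d - k = Suc (d - Suc k)" using Suc.prems by simp
  show ?case using pdiff_degree[OF IH(1)] IH(2) unfolding dk by (simp add: algebra_simps)
qed

lemma funpow_fdiff:
  "(fdiff ^^ k) f a = (\<Sum>j\<le>k. (-1) ^ (k - j) * of_nat (k choose j) * f (a + int j))"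
proof (induction k arbitrary: f)
  case (Suc k)
  let ?c = "\<lambda>j. (-1) ^ (k - j) * of_nat (k choose j) :: complex"
  have "(fdiff ^^ Suc k) f a = (\<Sum>j\<le>k. ?c j * (f (a + int j + 1) - f (a + int j)))"
    by (simp add: funpow_Suc_right Suc.IH fdiff_def del: funpow.simps)
  also have "\<dots> = (\<Sum>j\<le>k. ?c j * f (a + int (Suc j))) - (\<Sum>j\<le>k. ?c j * f (a + int j))"
    by (simp add: algebra_simps sum_subtractf)
  \<comment> \<open>The added summand has the coefficient \<open>k choose Suc k\<close>, which is 0;
    with it, Pascal's rule applies termwise after an index shift.\<close>
  also have "(\<Sum>j\<le>k. ?c j * f (a + int j)) = (\<Sum>j\<le>Suc k. ?c j * f (a + int j))"
    by simp
  also have "\<dots> = ?c 0 * f a + (\<Sum>j\<le>k. ?c (Suc j) * f (a + int (Suc j)))"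
    by (subst sum.atMost_Suc_shift) simp
  finally have "(fdiff ^^ Suc k) f a
      = - ?c 0 * f a + (\<Sum>j\<le>k. (?c j - ?c (Suc j)) * f (a + int (Suc j)))"
    by (simp add: algebra_simps sum_subtractf)
  also have "(\<Sum>j\<le>k. (?c j - ?c (Suc j)) * f (a + int (Suc j)))
      = (\<Sum>j\<le>k. (-1) ^ (Suc k - Suc j) * of_nat (Suc k choose Suc j) * f (a + int (Suc j)))"
  proof (rule sum.cong, simp)
    fix j assume j: "j \<in> {..k}"
    show "(?c j - ?c (Suc j)) * f (a + int (Suc j))
      = (-1) ^ (Suc k - Suc j) * of_nat (Suc k choose Suc j) * f (a + int (Suc j))"
    proof (cases "j = k")
      case False
      with j have "k - j = Suc (k - Suc j)" by auto
      then show ?thesis by (simp add: algebra_simps)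
    qed simp
  qed
  finally show ?case
    by (subst sum.atMost_Suc_shift) simp
qed simp

section \<open>Divided differences over consecutive integers\<close>

lemma prod_diff_factorials:
  "j \<le> k \<Longrightarrow> (\<Prod>s\<in>{..k} - {j}. of_int (int j - int s) :: complex) = (-1) ^ (k - j) * fact j * fact (k - j)"
proof (induction k)
  case (Suc k)
  show ?case
  proof (cases "j = Suc k")
    case True
    have eq: "{..Suc k} - {j} = {..k}" using True by auto
    have "(\<Prod>s\<le>k. of_int (int (Suc k) - int s) :: complex) = fact (Suc k)"
      by (simp only: fact_prod_rev atLeast0LessThan lessThan_Suc_atMost of_nat_prod flip: of_nat_fact)
         (rule prod.cong, auto)
    then show ?thesis unfolding eq by (simp add: True)
  next
    case False
    then have "{..Suc k} - {j} = insert (Suc k) ({..k} - {j})" by auto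
    then have "(\<Prod>s\<in>{..Suc k} - {j}. of_int (int j - int s) :: complex)
      = of_int (int j - int (Suc k)) * (\<Prod>s\<in>{..k} - {j}. of_int (int j - int s))"
      by simp
    moreover have "Suc k - j = Suc (k - j)" using False Suc.prems by auto
    moreover have "(of_int (int j - int (Suc k)) :: complex) = - of_nat (Suc (k - j))"
      using False Suc.prems by (simp add: of_nat_diff)
    ultimately show ?thesis using Suc False by (simp add: algebra_simps)
  qed
qed simp

lemma prod_diff_interval:
  assumes "j \<le> k"
  shows "(\<Prod>s\<in>{a..a + int k} - {a + int j}. of_int (a + int j - s) :: complex)
    = (-1) ^ (k - j) * fact j * fact (k - j)"
proof -
  have "{a..a + int k} - {a + int j} = (\<lambda>s. a + int s) ` ({..k} - {j})"
  proof (intro equalityI subsetI)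
    fix t assume "t \<in> {a..a + int k} - {a + int j}"
    then have "t = a + int (nat (t - a))" "nat (t - a) \<in> {..k} - {j}" by auto
    then show "t \<in> (\<lambda>s. a + int s) ` ({..k} - {j})" by blast
  qed auto
  then show ?thesis
    by (simp add: prod_diff_factorials[OF assms, symmetric] prod.reindex inj_on_def)
qed

lemma sum_int_interval: "(\<Sum>q\<in>{a..a + int k}. h q) = (\<Sum>j\<le>k. h (a + int j))"
proof -
  have "{a..a + int k} = (\<lambda>j. a + int j) ` {..k}"
  proof (intro equalityI subsetI)
    fix t assume "t \<in> {a..a + int k}"
    then have "t = a + int (nat (t - a))" "nat (t - a) \<in> {..k}" by auto
    then show "t \<in> (\<lambda>s. a + int s) ` {..k}" by blast
  qed auto
  then show ?thesis by (simp add: sum.reindex inj_on_def)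
qed

lemma divided_diff_consecutive:
  "divided_diff {a..a + int k} f = (fdiff ^^ k) f a / fact k"
  unfolding divided_diff_def sum_int_interval funpow_fdiff sum_divide_distrib
proof (rule sum.cong, simp)
  fix j assume "j \<in> {..k}"
  then have j: "j \<le> k" by simp
  then have "of_nat (k choose j) = (fact k / (fact j * fact (k - j)) :: complex)"
    by (simp add: binomial_fact)
  then show "f (a + int j) / (\<Prod>s\<in>{a..a + int k} - {a + int j}. of_int (a + int j - s))
      = (-1) ^ (k - j) * of_nat (k choose j) * f (a + int j) / fact k"
    unfolding prod_diff_interval[OF j] by (simp add: field_simps flip: power_add)
qed

text \<open>For fixed \<open>q\<close>, this collects all blocks that contain \<open>q\<close>. The
  denominators are again binomial coefficients up to sign and factorials, so the sum over the
  starting point is a difference of order \<open>k\<close>. This later makes numerators polynomial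
  in \<open>q\<close>.\<close>

lemma sum_over_blocks:
  "(\<Sum>a\<in>{q - int k..q}. g a / (\<Prod>s\<in>{a..a + int k} - {q}. of_int (q - s)))
    = (-1) ^ k * (fdiff ^^ k) g (q - int k) / fact k"
proof -
  have "(\<Sum>a\<in>{q - int k..q}. g a / (\<Prod>s\<in>{a..a + int k} - {q}. of_int (q - s)))
    = (\<Sum>j\<le>k. g (q - int k + int j) / (\<Prod>s\<in>{q - int k + int j..q - int k + int j + int k} - {q}. of_int (q - s)))"
    by (simp only: sum_int_interval[of _ "q - int k" k, simplified])
  also have "\<dots> = (\<Sum>j\<le>k. (-1) ^ k * ((-1) ^ (k - j) * of_nat (k choose j) * g (q - int k + int j)) / fact k)"
  proof (rule sum.cong, simp)
    fix j assume j: "j \<in> {..k}"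
    \<comment> \<open>In the block that starts at \<open>q - k + j\<close>, the point
      \<open>q\<close> has position \<open>k - j\<close>.\<close>
    then have q: "q = (q - int k + int j) + int (k - j)" by auto
    have "(\<Prod>s\<in>{q - int k + int j..q - int k + int j + int k} - {q}. of_int (q - s) :: complex)
      = (-1) ^ (k - (k - j)) * fact (k - j) * fact (k - (k - j))"
      using prod_diff_interval[of "k - j" k "q - int k + int j"] q by (simp del: of_nat_diff)
    moreover have "of_nat (k choose j) = (fact k / (fact j * fact (k - j)) :: complex)"
      using j by (simp add: binomial_fact)
    moreover have "(-1 :: complex) ^ k = (-1) ^ (k - j) * (-1) ^ j"
      using j by (simp flip: power_add)
    ultimately show "g (q - int k + int j) / (\<Prod>s\<in>{q - int k + int j..q - int k + int j + int k} - {q}. of_int (q - s))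
      = (-1) ^ k * ((-1) ^ (k - j) * of_nat (k choose j) * g (q - int k + int j)) / fact k"
      using j by (simp add: field_simps flip: power_add)
  qed
  also have "\<dots> = (-1) ^ k * (fdiff ^^ k) g (q - int k) / fact k"
    by (simp add: funpow_fdiff sum_distrib_left sum_divide_distrib)
  finally show ?thesis .
qed

section \<open>Summation by parts\<close>

lemma sum_telescope_int:
  fixes a b :: int and h :: "int \<Rightarrow> complex"
  shows "a \<le> b \<Longrightarrow> (\<Sum>q\<in>{a..<b}. h (q + 1) - h q) = h b - h a"
proof (induction b rule: int_ge_induct)
  case (step b)
  then have "{a..<b + 1} = insert b {a..<b}" by auto
  then show ?case using step by simp
qed simp

text \<open>Sum by parts \<open>k\<close> times. Each step lowers the degree of \<open>E\<close>,
  until only the zero polynomial is left for \<open>k = 0\<close>, and the boundary terms involve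
  \<open>f\<close> only at the \<open>k\<close> integers from \<open>a\<close> on and from
  \<open>b\<close> on.\<close>

lemma sum_poly_fdiff_vanishes:
  assumes "E = 0 \<or> degree E < k" and "a \<le> b"
    and "\<And>q. q \<in> {a..<a + int k} \<union> {b..<b + int k} \<Longrightarrow> f q = 0"
  shows "(\<Sum>q\<in>{a..<b}. poly E (of_int q) * (fdiff ^^ k) f q) = 0"
  using assms(1,3)
proof (induction k arbitrary: E f)
  case 0
  then show ?case by simp
next
  case (Suc k)
  define g where "g = (fdiff ^^ k) f"
  have g0: "g a = 0" "g b = 0"
    unfolding g_def funpow_fdiff using Suc.prems(2) by (auto intro!: sum.neutral)
  have shift: "g (q + 1) = (fdiff ^^ k) (\<lambda>y. f (y + 1)) q" for q
    unfolding g_def funpow_fdiff by (simp add: algebra_simps)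
  have "degree E \<le> k" using Suc.prems(1) by auto
  then have E': "pdiff E = 0 \<or> degree (pdiff E) < k"
    using pdiff_degree[of E k] by (cases k) auto
  \<comment> \<open>The shifted \<open>f\<close> still vanishes at the first \<open>k\<close>
    integers from \<open>a\<close> and from \<open>b\<close>, which is what order \<open>k\<close>
    requires.\<close>
  have "(\<Sum>q\<in>{a..<b}. poly (pdiff E) (of_int q) * g (q + 1)) = 0"
    unfolding shift by (rule Suc.IH[OF E']) (rule Suc.prems(2), auto)
  \<comment> \<open>The product rule \<open>E(q) (g(q+1) - g(q)) = (E(q+1) g(q+1) - E(q) g(q)) -
    (E(q+1) - E(q)) g(q+1)\<close>, summed over \<open>q\<close>.\<close>
  moreover have "(\<Sum>q\<in>{a..<b}. poly E (of_int q) * (fdiff ^^ Suc k) f q)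
     = (\<Sum>q\<in>{a..<b}. poly E (of_int (q + 1)) * g (q + 1) - poly E (of_int q) * g q)
       - (\<Sum>q\<in>{a..<b}. poly (pdiff E) (of_int q) * g (q + 1))"
    unfolding sum_subtractf[symmetric]
    by (rule sum.cong) (simp_all add: poly_pdiff fdiff_def g_def[symmetric] algebra_simps)
  moreover have "(\<Sum>q\<in>{a..<b}. poly E (of_int (q + 1)) * g (q + 1) - poly E (of_int q) * g q) = 0"
    using sum_telescope_int[OF assms(2), of "\<lambda>q. poly E (of_int q) * g q"] g0 by simp
  ultimately show ?case by simp
qed

section \<open>Blocks of nodes and the interlacing box\<close>

lemma prod_pairs_remove:
  fixes F :: "nat \<Rightarrow> nat \<Rightarrow> complex"
  assumes "finite A" and "k \<in> A"
  shows "(\<Prod>i\<in>A. \<Prod>j\<in>{j \<in> A. i < j}. F i j) =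
    (\<Prod>i\<in>{i \<in> A. i < k}. F i k) * (\<Prod>j\<in>{j \<in> A. k < j}. F k j)
    * (\<Prod>i\<in>A - {k}. \<Prod>j\<in>{j \<in> A - {k}. i < j}. F i j)"
proof -
  have split: "(\<Prod>j\<in>{j \<in> A. i < j}. F i j)
      = (if i < k then F i k else 1) * (\<Prod>j\<in>{j \<in> A - {k}. i < j}. F i j)" for i
  proof (cases "i < k")
    case True
    then have "{j \<in> A. i < j} = insert k {j \<in> A - {k}. i < j}" using assms by auto
    then show ?thesis using True assms by simp
  next
    case False
    then have "{j \<in> A. i < j} = {j \<in> A - {k}. i < j}" by auto
    then show ?thesis using False by simp
  qed
  have "(\<Prod>i\<in>A. \<Prod>j\<in>{j \<in> A. i < j}. F i j)
      = (\<Prod>j\<in>{j \<in> A. k < j}. F k j) * (\<Prod>i\<in>A - {k}. \<Prod>j\<in>{j \<in> A. i < j}. F i j)"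
    using assms by (rule prod.remove)
  also have "(\<Prod>i\<in>A - {k}. \<Prod>j\<in>{j \<in> A. i < j}. F i j)
      = (\<Prod>i\<in>A - {k}. if i < k then F i k else 1) * (\<Prod>i\<in>A - {k}. \<Prod>j\<in>{j \<in> A - {k}. i < j}. F i j)"
    unfolding split by (rule prod.distrib)
  also have "(\<Prod>i\<in>A - {k}. if i < k then F i k else 1) = (\<Prod>i\<in>{i \<in> A. i < k}. F i k)"
    using assms by (intro prod.mono_neutral_cong_right) auto
  finally show ?thesis by simp
qed

definition vandermonde :: "nat set \<Rightarrow> (nat \<Rightarrow> int) \<Rightarrow> complex" where
  "vandermonde A m = (\<Prod>i\<in>A. \<Prod>j\<in>{j \<in> A. i < j}. of_int (m i - m j))"

lemma vandermonde_cong: "(\<And>i. i \<in> A \<Longrightarrow> m i = m' i) \<Longrightarrow> vandermonde A m = vandermonde A m'"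
  by (simp add: vandermonde_def)

text \<open>The sign counts the factors with \<open>i\<close> as second index, which have to be
  reversed.\<close>

lemma vandermonde_remove:
  assumes "finite A" and "i \<in> A"
  shows "vandermonde A m = (-1) ^ card {j \<in> A. j < i} * vandermonde (A - {i}) m
     * (\<Prod>j\<in>A - {i}. of_int (m i - m j))"
proof -
  have "A - {i} = {j \<in> A. j < i} \<union> {j \<in> A. i < j}" by auto
  then have "(\<Prod>j\<in>A - {i}. of_int (m i - m j))
      = (\<Prod>j\<in>{j \<in> A. j < i}. of_int (m i - m j) :: complex) * (\<Prod>j\<in>{j \<in> A. i < j}. of_int (m i - m j))"
    using assms by (simp add: prod.union_disjoint disjoint_iff)
  moreover have "(\<Prod>j\<in>{j \<in> A. j < i}. of_int (m j - m i) :: complex)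
      = (-1) ^ card {j \<in> A. j < i} * (\<Prod>j\<in>{j \<in> A. j < i}. of_int (m i - m j))"
    by (simp add: prod_constant[symmetric] prod.distrib[symmetric] del: prod_constant)
  ultimately show ?thesis
    unfolding vandermonde_def by (subst prod_pairs_remove[OF assms]) simp
qed

lemma sum_PiE_remove:
  assumes "i \<in> A"
  shows "(\<Sum>m\<in>PiE A B. F m) = (\<Sum>m\<in>PiE (A - {i}) B. \<Sum>a\<in>B i. F (m(i := a)))"
proof -
  have A: "A = insert i (A - {i})" using assms by auto
  have "(\<Sum>m\<in>PiE A B. F m) = (\<Sum>m\<in>(\<lambda>(a, m). m(i := a)) ` (B i \<times> PiE (A - {i}) B). F m)"
    by (subst A, subst PiE_insert_eq) simp
  also have "\<dots> = (\<Sum>(a, m)\<in>B i \<times> PiE (A - {i}) B. F (m(i := a)))"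
    by (subst sum.reindex[OF inj_combinator]) (auto simp: case_prod_unfold intro!: sum.cong)
  also have "\<dots> = (\<Sum>m\<in>PiE (A - {i}) B. \<Sum>a\<in>B i. F (m(i := a)))"
    unfolding sum.cartesian_product[symmetric] by (rule sum.swap)
  finally show ?thesis .
qed

section \<open>Blocks of consecutive nodes and the ranges of shifted coordinates\<close>

definition block :: "nat \<Rightarrow> int \<Rightarrow> int set" where
  "block k a = {a..a + int k}"

definition nodes :: "nat \<Rightarrow> nat set \<Rightarrow> (nat \<Rightarrow> int) \<Rightarrow> int set" where
  "nodes k A m = (\<Union>i\<in>A. block k (m i))"

lemma finite_block [simp]: "finite (block k a)" and card_block [simp]: "card (block k a) = Suc k"
  by (simp_all add: block_def nat_add_distrib)

lemma finite_nodes [simp]: "finite A \<Longrightarrow> finite (nodes k A m)"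
  by (simp add: nodes_def)

lemma nodes_cong: "(\<And>i. i \<in> A \<Longrightarrow> m i = m' i) \<Longrightarrow> nodes k A m = nodes k A m'"
  by (simp add: nodes_def)

text \<open>The parameter \<open>k\<close> stands for \<open>\<theta> - 1\<close>.\<close>

locale interlacing =
  fixes k n :: nat and l :: "nat \<Rightarrow> int"
  assumes gap: "\<And>i. i \<in> {1..n} \<Longrightarrow> l (Suc i) + int (Suc k) \<le> l i"
begin

definition weight_poly :: "complex poly" where
  "weight_poly = (\<Prod>i\<in>{1..Suc n}. root_poly {l i - int k..l i - 1})"

abbreviation weight :: "int \<Rightarrow> complex" where
  "weight y \<equiv> poly weight_poly (of_int y)"

text \<open>The range that interlacing leaves for \<open>m i\<close> in shifted coordinates; the
  upper end is lowered by \<theta> because the shift of \<open>l i\<close> contains one more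
  \<theta> than that of \<open>m i\<close>. The blocks that start in \<open>narrow i\<close> sweep
  out \<open>wide i\<close>.\<close>

definition narrow :: "nat \<Rightarrow> int set" where
  "narrow i = {l (Suc i)..l i - int (Suc k)}"

definition wide :: "nat \<Rightarrow> int set" where
  "wide i = {l (Suc i)..<l i}"

abbreviation mult_weight :: "nat set \<Rightarrow> (nat \<Rightarrow> int) \<Rightarrow> complex" where
  "mult_weight A m \<equiv> vandermonde A m * (\<Prod>i\<in>A. weight (m i))"

lemma finite_narrow [simp]: "finite (narrow i)" and finite_wide [simp]: "finite (wide i)"
  by (simp_all add: narrow_def wide_def)

lemma weight_zero:
  assumes "i \<in> {1..Suc n}" and "l i - int k \<le> y" and "y < l i"
  shows "weight y = 0"
  using assms unfolding weight_poly_def poly_prod poly_root_poly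
  by (intro prod_zero bexI[of _ i] bexI[of _ y]) auto

lemma decreasing: "1 \<le> i \<Longrightarrow> i < j \<Longrightarrow> j \<le> Suc n \<Longrightarrow> l j + int (Suc k) \<le> l i"
proof (induction j)
  case (Suc j)
  have s: "l (Suc j) + int (Suc k) \<le> l j" using gap[of j] Suc.prems by auto
  show ?case
  proof (cases "i = j")
    case False
    then have "l j + int (Suc k) \<le> l i" using Suc by auto
    then show ?thesis using s by linarith
  qed (use s in simp)
qed simp

lemma wide_disjoint:
  assumes "i \<in> {1..n}" "j \<in> {1..n}" "i \<noteq> j"
  shows "wide i \<inter> wide j = {}"
proof -
  have *: "wide i \<inter> wide j = {}" if "i < j" "1 \<le> i" "j \<le> n" for i j
  proof -
    have "l j \<le> l (Suc i)"
      using decreasing[of "Suc i" j] that by (cases "j = Suc i") auto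
    then show ?thesis by (auto simp: wide_def)
  qed
  from assms show ?thesis using *[of i j] *[of j i] by (cases "i < j") auto
qed

lemma block_subset_wide: "a \<in> narrow i \<Longrightarrow> block k a \<subseteq> wide i"
  by (auto simp: narrow_def wide_def block_def)

text \<open>With \<open>q = a + j\<close>, the constraint \<open>a \<in> narrow i\<close> may be dropped because the weight vanishes at the \<open>k\<close> integers below
  \<open>l i\<close> and \<open>l (Suc i)\<close>.\<close>

lemma regroup:
  assumes "i \<in> {1..n}"
  shows "(\<Sum>a\<in>narrow i. \<Sum>q\<in>block k a. weight a * h a q)
       = (\<Sum>q\<in>wide i. \<Sum>a\<in>{q - int k..q}. weight a * h a q)"
proof -
  have "(\<Sum>a\<in>narrow i. \<Sum>q\<in>block k a. weight a * h a q)
      = (\<Sum>a\<in>narrow i. \<Sum>q\<in>{q \<in> wide i. a \<in> {q - int k..q}}. weight a * h a q)"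
  proof (rule sum.cong, simp)
    fix a assume "a \<in> narrow i"
    then have "block k a = {q \<in> wide i. a \<in> {q - int k..q}}"
      by (auto simp: narrow_def wide_def block_def)
    then show "(\<Sum>q\<in>block k a. weight a * h a q) = (\<Sum>q\<in>{q \<in> wide i. a \<in> {q - int k..q}}. weight a * h a q)"
      by simp
  qed
  also have "\<dots> = (\<Sum>q\<in>wide i. \<Sum>a\<in>{a \<in> narrow i. a \<in> {q - int k..q}}. weight a * h a q)"
    by (rule sum.swap_restrict) auto
  also have "\<dots> = (\<Sum>q\<in>wide i. \<Sum>a\<in>{q - int k..q}. weight a * h a q)"
  proof (rule sum.cong, simp)
    fix q assume q: "q \<in> wide i"
    show "(\<Sum>a\<in>{a \<in> narrow i. a \<in> {q - int k..q}}. weight a * h a q) = (\<Sum>a\<in>{q - int k..q}. weight a * h a q)"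
    proof (rule sum.mono_neutral_left)
      show "\<forall>a\<in>{q - int k..q} - {a \<in> narrow i. a \<in> {q - int k..q}}. weight a * h a q = 0"
      proof
        fix a assume "a \<in> {q - int k..q} - {a \<in> narrow i. a \<in> {q - int k..q}}"
        then have a: "q - int k \<le> a" "a \<le> q" "a < l (Suc i) \<or> l i - int (Suc k) < a"
          by (auto simp: narrow_def)
        from a(3) have "weight a = 0"
        proof
          assume "a < l (Suc i)"
          then show ?thesis using a q assms by (intro weight_zero[of "Suc i"]) (auto simp: wide_def)
        next
          assume "l i - int (Suc k) < a"
          then show ?thesis using a q assms by (intro weight_zero[of i]) (auto simp: wide_def)
        qed
        then show "weight a * h a q = 0" by simp
      qed
    qed auto
  qed
  finally show ?thesis .
qed

text \<open>Makes the coefficient of each value at \<open>q\<close> explicit: pick the index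
  \<open>i\<close> whose block contains \<open>q\<close>, expand the Vandermonde product along
  \<open>i\<close>, and sum over the start \<open>a\<close> of that block before summing over
  \<open>q\<close>. The function \<open>g\<close> may depend on \<open>m\<close> and
  \<open>A\<close> may be a proper subset, because the cancellation of polar parts applies this to
  the box without one coordinate and to a numerator that depends on \<open>m\<close>.\<close>

lemma box_expansion:
  assumes A: "A \<subseteq> {1..n}"
  shows "(\<Sum>m\<in>PiE A narrow. mult_weight A m * divided_diff (nodes k A m) (g m)) =
    (\<Sum>i\<in>A. (-1) ^ card {j \<in> A. j < i} * (\<Sum>m\<in>PiE (A - {i}) narrow. mult_weight (A - {i}) m *
       (\<Sum>q\<in>wide i. (\<Sum>a\<in>{q - int k..q}. weight a * (\<Prod>j\<in>A - {i}. of_int (a - m j))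
            / (\<Prod>s\<in>block k a - {q}. of_int (q - s)) * g (m(i := a)) q)
          / poly (root_poly (nodes k (A - {i}) m)) (of_int q))))"
proof -
  have finA: "finite A" using A finite_subset by blast
  \<comment> \<open>The blocks lie in disjoint intervals, so the sum over the nodes splits by
    blocks.\<close>
  have inner: "mult_weight A m * divided_diff (nodes k A m) (g m)
      = (\<Sum>i\<in>A. \<Sum>q\<in>block k (m i). mult_weight A m * (g m q / (\<Prod>s\<in>nodes k A m - {q}. of_int (q - s))))"
    if m: "m \<in> PiE A narrow" for m
  proof -
    have "divided_diff (nodes k A m) (g m)
      = (\<Sum>i\<in>A. \<Sum>q\<in>block k (m i). g m q / (\<Prod>s\<in>nodes k A m - {q}. of_int (q - s)))"
      unfolding divided_diff_def
    proof (subst (1) nodes_def, rule sum.UNION_disjoint[OF finA])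
      show "\<forall>i\<in>A. \<forall>j\<in>A. i \<noteq> j \<longrightarrow> block k (m i) \<inter> block k (m j) = {}"
      proof (intro ballI impI)
        fix i j assume "i \<in> A" "j \<in> A" "i \<noteq> j"
        then show "block k (m i) \<inter> block k (m j) = {}"
          using wide_disjoint[of i j] A PiE_mem[OF m] block_subset_wide[of "m i" i] block_subset_wide[of "m j" j]
          by blast
      qed
    qed (simp add: block_def)
    then show ?thesis by (simp add: sum_distrib_left)
  qed
  \<comment> \<open>For \<open>q\<close> in the block at \<open>a\<close>, the differences to the
    other nodes split into those inside the block and those to the remaining blocks; the latter form
    \<open>root_poly\<close> at \<open>q\<close> and do not depend on \<open>a\<close>.\<close>
  have summand: "mult_weight A (m(i := a)) * (g (m(i := a)) q / (\<Prod>s\<in>nodes k A (m(i := a)) - {q}. of_int (q - s)))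
      = weight a * ((-1) ^ card {j \<in> A. j < i} * mult_weight (A - {i}) m * (\<Prod>j\<in>A - {i}. of_int (a - m j))
            / (\<Prod>s\<in>block k a - {q}. of_int (q - s)) * g (m(i := a)) q
          / poly (root_poly (nodes k (A - {i}) m)) (of_int q))"
    if i: "i \<in> A" and m: "m \<in> PiE (A - {i}) narrow" and a: "a \<in> narrow i" and q: "q \<in> block k a"
    for i m a q
  proof -
    have v: "vandermonde A (m(i := a)) = (-1) ^ card {j \<in> A. j < i} * vandermonde (A - {i}) m
        * (\<Prod>j\<in>A - {i}. of_int (a - m j))"
    proof -
      have "vandermonde (A - {i}) (m(i := a)) = vandermonde (A - {i}) m"
        by (rule vandermonde_cong) simp
      then show ?thesis unfolding vandermonde_remove[OF finA i] by simp
    qed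
    have w: "(\<Prod>j\<in>A. weight ((m(i := a)) j)) = weight a * (\<Prod>j\<in>A - {i}. weight (m j))"
      using finA i by (simp add: prod.remove)
    have "nodes k A (m(i := a)) = nodes k (insert i (A - {i})) (m(i := a))"
      by (simp only: insert_Diff[OF i])
    also have "\<dots> = block k a \<union> nodes k (A - {i}) (m(i := a))"
      unfolding nodes_def by (simp only: UN_insert fun_upd_same)
    also have "nodes k (A - {i}) (m(i := a)) = nodes k (A - {i}) m"
      by (rule nodes_cong) simp
    finally have "nodes k A (m(i := a)) = block k a \<union> nodes k (A - {i}) m" .
    moreover have disj: "block k a \<inter> nodes k (A - {i}) m = {}"
    proof -
      have "block k a \<inter> block k (m j) = {}" if "j \<in> A - {i}" for j
        using wide_disjoint[of i j] A PiE_mem[OF m that] block_subset_wide[of "m j" j] that i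
          block_subset_wide[OF a] by blast
      then show ?thesis by (auto simp: nodes_def)
    qed
    ultimately have "nodes k A (m(i := a)) - {q} = (block k a - {q}) \<union> nodes k (A - {i}) m"
      using q by auto
    then have d: "(\<Prod>s\<in>nodes k A (m(i := a)) - {q}. of_int (q - s) :: complex)
        = (\<Prod>s\<in>block k a - {q}. of_int (q - s)) * poly (root_poly (nodes k (A - {i}) m)) (of_int q)"
      using disj finA by (simp add: poly_root_poly prod.union_disjoint block_def disjoint_iff)
    show ?thesis unfolding v w d by simp
  qed
  have "(\<Sum>m\<in>PiE A narrow. mult_weight A m * divided_diff (nodes k A m) (g m))
     = (\<Sum>m\<in>PiE A narrow. \<Sum>i\<in>A. \<Sum>q\<in>block k (m i). mult_weight A m * (g m q / (\<Prod>s\<in>nodes k A m - {q}. of_int (q - s))))"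
    by (rule sum.cong[OF refl inner])
  also have "\<dots> = (\<Sum>i\<in>A. \<Sum>m\<in>PiE A narrow. \<Sum>q\<in>block k (m i). mult_weight A m * (g m q / (\<Prod>s\<in>nodes k A m - {q}. of_int (q - s))))"
    by (rule sum.swap)
  also have "\<dots> = (\<Sum>i\<in>A. (-1) ^ card {j \<in> A. j < i} * (\<Sum>m\<in>PiE (A - {i}) narrow. mult_weight (A - {i}) m *
       (\<Sum>q\<in>wide i. (\<Sum>a\<in>{q - int k..q}. weight a * (\<Prod>j\<in>A - {i}. of_int (a - m j))
            / (\<Prod>s\<in>block k a - {q}. of_int (q - s)) * g (m(i := a)) q)
          / poly (root_poly (nodes k (A - {i}) m)) (of_int q))))"
  proof (rule sum.cong, simp)
    fix i assume i: "i \<in> A"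
    have "(\<Sum>m\<in>PiE A narrow. \<Sum>q\<in>block k (m i). mult_weight A m * (g m q / (\<Prod>s\<in>nodes k A m - {q}. of_int (q - s))))
      = (\<Sum>m\<in>PiE (A - {i}) narrow. \<Sum>a\<in>narrow i. \<Sum>q\<in>block k a. weight a *
          ((-1) ^ card {j \<in> A. j < i} * mult_weight (A - {i}) m * (\<Prod>j\<in>A - {i}. of_int (a - m j))
            / (\<Prod>s\<in>block k a - {q}. of_int (q - s)) * g (m(i := a)) q
          / poly (root_poly (nodes k (A - {i}) m)) (of_int q)))"
      unfolding sum_PiE_remove[OF i]
      by (intro sum.cong refl) (simp only: fun_upd_same, intro sum.cong refl summand[OF i], assumption+)
    also have "\<dots> = (\<Sum>m\<in>PiE (A - {i}) narrow. \<Sum>q\<in>wide i. \<Sum>a\<in>{q - int k..q}. weight a *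
          ((-1) ^ card {j \<in> A. j < i} * mult_weight (A - {i}) m * (\<Prod>j\<in>A - {i}. of_int (a - m j))
            / (\<Prod>s\<in>block k a - {q}. of_int (q - s)) * g (m(i := a)) q
          / poly (root_poly (nodes k (A - {i}) m)) (of_int q)))"
      by (rule sum.cong[OF refl], rule regroup, rule subsetD[OF A i])
    also have "\<dots> = (-1) ^ card {j \<in> A. j < i} * (\<Sum>m\<in>PiE (A - {i}) narrow. mult_weight (A - {i}) m *
       (\<Sum>q\<in>wide i. (\<Sum>a\<in>{q - int k..q}. weight a * (\<Prod>j\<in>A - {i}. of_int (a - m j))
            / (\<Prod>s\<in>block k a - {q}. of_int (q - s)) * g (m(i := a)) q)
          / poly (root_poly (nodes k (A - {i}) m)) (of_int q)))"
      unfolding sum_distrib_left sum_divide_distrib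
      by (intro sum.cong refl) simp
    finally show "(\<Sum>m\<in>PiE A narrow. \<Sum>q\<in>block k (m i). mult_weight A m * (g m q / (\<Prod>s\<in>nodes k A m - {q}. of_int (q - s))))
      = (-1) ^ card {j \<in> A. j < i} * (\<Sum>m\<in>PiE (A - {i}) narrow. mult_weight (A - {i}) m *
       (\<Sum>q\<in>wide i. (\<Sum>a\<in>{q - int k..q}. weight a * (\<Prod>j\<in>A - {i}. of_int (a - m j))
            / (\<Prod>s\<in>block k a - {q}. of_int (q - s)) * g (m(i := a)) q)
          / poly (root_poly (nodes k (A - {i}) m)) (of_int q)))" .
  qed
  finally show ?thesis .
qed

end

section \<open>The averaging identity for divided differences\<close>

lemma sum_antisymmetric:
  fixes u :: "int \<Rightarrow> complex"
  shows "(\<Sum>a\<in>X. \<Sum>b\<in>X. u a * (u b * of_int (b - a))) = 0"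
proof -
  let ?S = "\<Sum>a\<in>X. \<Sum>b\<in>X. u a * (u b * of_int (b - a))"
  have "?S = (\<Sum>b\<in>X. \<Sum>a\<in>X. u a * (u b * of_int (b - a)))"
    by (rule sum.swap)
  also have "\<dots> = - ?S"
    by (simp add: sum_negf[symmetric] algebra_simps)
  finally show ?thesis by (simp add: eq_neg_iff_add_eq_0)
qed

lemma divided_diff_diff: "divided_diff S (\<lambda>a. f a - g a) = divided_diff S f - divided_diff S g"
  by (simp add: divided_diff_def diff_divide_distrib sum_subtractf)

lemma divided_diff_cong: "(\<And>s. s \<in> S \<Longrightarrow> f s = g s) \<Longrightarrow> divided_diff S f = divided_diff S g"
  by (simp add: divided_diff_def)

lemma funpow_fdiff_diff: "(fdiff ^^ k) (\<lambda>a. f a - g a) = (\<lambda>a. (fdiff ^^ k) f a - (fdiff ^^ k) g a)"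
  by (simp add: fun_eq_iff funpow_fdiff right_diff_distrib sum_subtractf)

lemma card_nodes:
  assumes "finite A" and "\<And>i j. i \<in> A \<Longrightarrow> j \<in> A \<Longrightarrow> i \<noteq> j \<Longrightarrow> block k (m i) \<inter> block k (m j) = {}"
  shows "card (nodes k A m) = card A * Suc k"
proof -
  have "card (nodes k A m) = (\<Sum>i\<in>A. card (block k (m i)))"
    unfolding nodes_def
  proof (rule card_UN_disjoint)
    show "\<forall>i\<in>A. \<forall>j\<in>A. i \<noteq> j \<longrightarrow> block k (m i) \<inter> block k (m j) = {}"
      using assms(2) by blast
  qed (simp_all add: assms(1))
  then show ?thesis by simp
qed

section \<open>Coefficients of the weighted sum and their polynomiality\<close>

context interlacing
begin

lemma nodes_disjoint_wide:
  assumes "A \<subseteq> {1..n}" "i \<in> {1..n}" "i \<notin> A" "m \<in> PiE A narrow"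
  shows "nodes k A m \<inter> wide i = {}"
proof -
  have "block k (m j) \<inter> wide i = {}" if "j \<in> A" for j
    using wide_disjoint[of j i] assms that block_subset_wide[OF PiE_mem[OF assms(4) that]] by blast
  then show ?thesis by (auto simp: nodes_def)
qed

lemma block_l_disjoint:
  assumes "i \<in> {1..Suc n}" "j \<in> {1..Suc n}" "i \<noteq> j"
  shows "block k (l i) \<inter> block k (l j) = {}"
proof -
  have *: "block k (l i) \<inter> block k (l j) = {}" if "i < j" "1 \<le> i" "j \<le> Suc n" for i j
    using decreasing[of i j] that by (auto simp: block_def)
  from assms show ?thesis using *[of i j] *[of j i] by (cases "i < j") auto
qed

lemma block_narrow_disjoint:
  assumes "A \<subseteq> {1..n}" "m \<in> PiE A narrow" "i \<in> A" "j \<in> A" "i \<noteq> j"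
  shows "block k (m i) \<inter> block k (m j) = {}"
proof -
  have "wide i \<inter> wide j = {}" using assms wide_disjoint by blast
  then show ?thesis
    using block_subset_wide[OF PiE_mem[OF assms(2,3)]] block_subset_wide[OF PiE_mem[OF assms(2,4)]] by blast
qed

lemma card_nodes_narrow:
  assumes "A \<subseteq> {1..n}" "m \<in> PiE A narrow"
  shows "card (nodes k A m) = card A * Suc k"
  by (rule card_nodes) (use assms finite_subset block_narrow_disjoint[OF assms] in blast)+

lemma card_nodes_l: "card (nodes k {1..Suc n} l) = Suc n * Suc k"
  using card_nodes[of "{1..Suc n}" k l] block_l_disjoint by simp

text \<open>The numerator left after summing over the blocks containing \<open>q\<close>, as a
  polynomial in \<open>q\<close>. By \<open>sum_over_blocks\<close> it is a difference of order
  \<open>k\<close> taken at \<open>q - k\<close>, whence the composition with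
  \<open>X - k\<close>.\<close>

definition num_poly :: "nat set \<Rightarrow> (nat \<Rightarrow> int) \<Rightarrow> complex poly" where
  "num_poly A m = smult ((-1) ^ k / fact k)
     (pcompose ((pdiff ^^ k) (weight_poly * (\<Prod>j\<in>A. [:- of_int (m j), 1:]))) [:- of_nat k, 1:])"

lemma poly_num_poly:
  "poly (num_poly A m) (of_int q) = (\<Sum>a\<in>{q - int k..q}. weight a * (\<Prod>j\<in>A. of_int (a - m j))
     / (\<Prod>s\<in>block k a - {q}. of_int (q - s)))"
proof -
  let ?p = "weight_poly * (\<Prod>j\<in>A. [:- of_int (m j), 1:])"
  have "(\<Sum>a\<in>{q - int k..q}. weight a * (\<Prod>j\<in>A. of_int (a - m j)) / (\<Prod>s\<in>block k a - {q}. of_int (q - s)))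
    = (\<Sum>a\<in>{q - int k..q}. poly ?p (of_int a) / (\<Prod>s\<in>{a..a + int k} - {q}. of_int (q - s)))"
    by (simp add: block_def poly_prod)
  also have "\<dots> = poly (num_poly A m) (of_int q)"
    unfolding sum_over_blocks funpow_fdiff_poly num_poly_def by (simp add: poly_pcompose)
  finally show ?thesis ..
qed

lemma degree_weight_poly: "degree weight_poly = Suc n * k"
  unfolding weight_poly_def by (subst degree_prod_eq_sum_degree) auto

text \<open>The \<open>k\<close> differences remove \<open>k\<close> from the degree
  \<open>Suc n * k + card A\<close>. This saving bounds the polynomial part of the coefficients by
  degree \<open>k\<close>.\<close>

lemma degree_num_poly:
  assumes "finite A"
  shows "degree (num_poly A m) \<le> n * k + card A"
proof -
  let ?p = "weight_poly * (\<Prod>j\<in>A. [:- of_int (m j), 1:])"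
  have "degree (\<Prod>j\<in>A. [:- of_int (m j), 1:] :: complex poly) \<le> card A"
    by (rule order.trans[OF degree_prod_sum_le[OF assms]]) simp
  then have "degree ?p \<le> Suc n * k + card A"
    by (intro order.trans[OF degree_mult_le] add_mono) (simp_all add: degree_weight_poly)
  then have "degree ((pdiff ^^ k) ?p) \<le> Suc n * k + card A - k"
    by (intro funpow_pdiff_degree[THEN conjunct1]) auto
  then have "degree (num_poly A m) \<le> Suc n * k + card A - k"
    unfolding num_poly_def by (simp add: degree_pcompose)
  then show ?thesis by simp
qed

text \<open>Expanding along a second coordinate, the residue at \<open>q\<close> is a double sum of \<open>u a * u b * (b - a)\<close>.\<close>

lemma polar_part_vanishes:
  assumes A: "A \<subseteq> {1..n}"
  shows "(\<Sum>m\<in>PiE A narrow. mult_weight A m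
     * divided_diff (nodes k A m) (\<lambda>q. poly (num_poly A m) (of_int q) / (z - of_int q))) = 0"
proof -
  have finA: "finite A" using A finite_subset by blast
  have "(\<Sum>a\<in>{q - int k..q}. weight a * (\<Prod>j\<in>A - {i}. of_int (a - m j))
            / (\<Prod>s\<in>block k a - {q}. of_int (q - s))
            * (poly (num_poly A (m(i := a))) (of_int q) / (z - of_int q))) = 0" if i: "i \<in> A" for i m q
  proof -
    define u where "u a = weight a * (\<Prod>j\<in>A - {i}. of_int (a - m j)) / (\<Prod>s\<in>block k a - {q}. of_int (q - s))" for a
    have "poly (num_poly A (m(i := a))) (of_int q) = (\<Sum>b\<in>{q - int k..q}. u b * of_int (b - a))" for a
      unfolding poly_num_poly u_def
    proof (rule sum.cong[OF refl])
      fix b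
      have "(\<Prod>j\<in>A. of_int (b - (m(i := a)) j) :: complex) = of_int (b - a) * (\<Prod>j\<in>A - {i}. of_int (b - m j))"
        using finA i by (simp add: prod.remove)
      then show "weight b * (\<Prod>j\<in>A. of_int (b - (m(i := a)) j)) / (\<Prod>s\<in>block k b - {q}. of_int (q - s))
        = weight b * (\<Prod>j\<in>A - {i}. of_int (b - m j)) / (\<Prod>s\<in>block k b - {q}. of_int (q - s)) * of_int (b - a)"
        by (simp del: of_int_diff)
    qed
    then have "(\<Sum>a\<in>{q - int k..q}. u a * (poly (num_poly A (m(i := a))) (of_int q) / (z - of_int q)))
      = (\<Sum>a\<in>{q - int k..q}. \<Sum>b\<in>{q - int k..q}. u a * (u b * of_int (b - a))) / (z - of_int q)"
      by (simp only: sum_distrib_left sum_divide_distrib times_divide_eq_right)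
    then show ?thesis unfolding sum_antisymmetric u_def by simp
  qed
  then show ?thesis unfolding box_expansion[OF A] by simp
qed

text \<open>Up to sign, the coefficient of \<open>f q\<close>, \<open>q \<in> wide i\<close>, in the weighted sum of divided differences of \<open>f\<close>.\<close>

definition profile :: "nat \<Rightarrow> int \<Rightarrow> complex" where
  "profile i q = (\<Sum>m\<in>PiE ({1..n} - {i}) narrow. mult_weight ({1..n} - {i}) m
     * (poly (num_poly ({1..n} - {i}) m) (of_int q) / poly (root_poly (nodes k ({1..n} - {i}) m)) (of_int q)))"

text \<open>Each summand of \<open>profile i\<close> is a rational function of \<open>q\<close> with
  poles at the nodes of the other blocks, which avoid \<open>wide i\<close>. Its polynomial part has
  degree less than \<open>Suc k\<close>, and the polar parts cancel in the weighted sum by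
  \<open>polar_part_vanishes\<close>.\<close>

lemma profile_polynomial:
  assumes i: "i \<in> {1..n}"
  obtains E where "E = 0 \<or> degree E < Suc k" and "\<And>q. q \<in> wide i \<Longrightarrow> profile i q = poly E (of_int q)"
proof -
  let ?A = "{1..n} - {i}"
  define good where "good m E \<longleftrightarrow> (E = 0 \<or> degree E < Suc k) \<and> (\<forall>z. z \<notin> of_int ` nodes k ?A m \<longrightarrow>
      poly (num_poly ?A m) z / poly (root_poly (nodes k ?A m)) z = poly E z
        + divided_diff (nodes k ?A m) (\<lambda>s. poly (num_poly ?A m) (of_int s) / (z - of_int s)))" for m E
  have "\<exists>E. good m E" if m: "m \<in> PiE ?A narrow" for m
  proof -
    \<comment> \<open>Degree count: \<open>n * k + (n - 1)\<close> is one less than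
      \<open>n * Suc k\<close>, the number \<open>(n - 1) * Suc k\<close> of nodes plus
      \<open>Suc k\<close>.\<close>
    have "degree (num_poly ?A m) \<le> n * k + (n - 1)"
      using degree_num_poly[of ?A m] i by simp
    also have "\<dots> < (n - 1) * Suc k + Suc k"
      using i by (cases n) auto
    also have "\<dots> = card (nodes k ?A m) + Suc k"
      using card_nodes_narrow[OF _ m] i by simp
    finally have "degree (num_poly ?A m) < card (nodes k ?A m) + Suc k" .
    then obtain E where "good m E"
    proof (rule partial_fractions[rotated])
      fix E
      assume E: "E = 0 \<or> degree E < Suc k"
        "\<And>z. z \<notin> of_int ` nodes k ?A m \<Longrightarrow>
          poly (num_poly ?A m) z / poly (root_poly (nodes k ?A m)) z = poly E z
            + divided_diff (nodes k ?A m) (\<lambda>s. poly (num_poly ?A m) (of_int s) / (z - of_int s))"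
      assume *: "\<And>E. good m E \<Longrightarrow> thesis"
      have "good m E" unfolding good_def by (intro conjI allI impI E)
      then show thesis by (rule *)
    qed simp_all
    then show ?thesis ..
  qed
  then have "\<forall>m\<in>PiE ?A narrow. \<exists>E. good m E" by simp
  from bchoice[OF this] obtain E where E: "\<forall>m\<in>PiE ?A narrow. good m (E m)" ..
  have E1: "E m = 0 \<or> degree (E m) < Suc k" if "m \<in> PiE ?A narrow" for m
    by (rule bspec[OF E that, unfolded good_def, THEN conjunct1])
  have E2: "poly (num_poly ?A m) z / poly (root_poly (nodes k ?A m)) z = poly (E m) z
        + divided_diff (nodes k ?A m) (\<lambda>s. poly (num_poly ?A m) (of_int s) / (z - of_int s))"
    if "m \<in> PiE ?A narrow" "z \<notin> of_int ` nodes k ?A m" for m z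
    by (rule bspec[OF E that(1), unfolded good_def, THEN conjunct2, THEN spec, THEN mp, OF that(2)])
  show thesis
  proof (rule that)
    let ?E = "\<Sum>m\<in>PiE ?A narrow. smult (mult_weight ?A m) (E m)"
    have "degree ?E \<le> k"
    proof (rule degree_sum_le)
      show "finite (PiE ?A narrow)" by (intro finite_PiE) auto
      fix m assume "m \<in> PiE ?A narrow"
      from E1[OF this] have "degree (E m) \<le> k" by (elim disjE) simp_all
      then show "degree (smult (mult_weight ?A m) (E m)) \<le> k"
        by (rule order.trans[OF degree_smult_le])
    qed
    then show "?E = 0 \<or> degree ?E < Suc k" by (intro disjI2) (simp only: less_Suc_eq_le)
    fix q assume q: "q \<in> wide i"
    have "poly (num_poly ?A m) (of_int q) / poly (root_poly (nodes k ?A m)) (of_int q)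
        = poly (E m) (of_int q)
          + divided_diff (nodes k ?A m) (\<lambda>s. poly (num_poly ?A m) (of_int s) / (of_int q - of_int s))"
      if m: "m \<in> PiE ?A narrow" for m
    proof (rule E2[OF m])
      show "(of_int q :: complex) \<notin> of_int ` nodes k ?A m"
        using nodes_disjoint_wide[OF _ i _ m] q by auto
    qed
    then have "profile i q = (\<Sum>m\<in>PiE ?A narrow. mult_weight ?A m * (poly (E m) (of_int q)
        + divided_diff (nodes k ?A m) (\<lambda>s. poly (num_poly ?A m) (of_int s) / (of_int q - of_int s))))"
      unfolding profile_def by (intro sum.cong[OF refl] arg_cong2[where f = "(*)"] refl)
    also have "\<dots> = (\<Sum>m\<in>PiE ?A narrow. mult_weight ?A m * poly (E m) (of_int q))"
      using polar_part_vanishes[of ?A "of_int q"] by (simp add: distrib_left sum.distrib Diff_subset)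
    finally show "profile i q = poly ?E (of_int q)" by (simp add: poly_sum)
  qed
qed

lemma box_expansion_profile:
  "(\<Sum>m\<in>PiE {1..n} narrow. mult_weight {1..n} m * divided_diff (nodes k {1..n} m) f)
    = (\<Sum>i\<in>{1..n}. (-1) ^ card {j \<in> {1..n}. j < i} * (\<Sum>q\<in>wide i. profile i q * f q))"
  unfolding box_expansion[OF subset_refl]
proof (intro sum.cong refl arg_cong2[where f = "(*)"])
  fix i
  let ?A = "{1..n} - {i}"
  have "(\<Sum>m\<in>PiE ?A narrow. mult_weight ?A m * (\<Sum>q\<in>wide i. (\<Sum>a\<in>{q - int k..q}. weight a * (\<Prod>j\<in>?A. of_int (a - m j))
       / (\<Prod>s\<in>block k a - {q}. of_int (q - s)) * f q) / poly (root_poly (nodes k ?A m)) (of_int q)))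
    = (\<Sum>m\<in>PiE ?A narrow. \<Sum>q\<in>wide i. mult_weight ?A m * (poly (num_poly ?A m) (of_int q)
       / poly (root_poly (nodes k ?A m)) (of_int q)) * f q)"
    unfolding sum_distrib_right[symmetric] poly_num_poly[symmetric] by (simp add: sum_distrib_left mult.assoc)
  also have "\<dots> = (\<Sum>q\<in>wide i. profile i q * f q)"
    unfolding profile_def sum_distrib_right by (rule sum.swap)
  finally show "(\<Sum>m\<in>PiE ?A narrow. mult_weight ?A m * (\<Sum>q\<in>wide i. (\<Sum>a\<in>{q - int k..q}. weight a * (\<Prod>j\<in>?A. of_int (a - m j))
       / (\<Prod>s\<in>block k a - {q}. of_int (q - s)) * f q) / poly (root_poly (nodes k ?A m)) (of_int q)))
    = (\<Sum>q\<in>wide i. profile i q * f q)" .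
qed

section \<open>The averaged divided difference and its evaluation\<close>

definition total :: complex where
  "total = (\<Sum>m\<in>PiE {1..n} narrow. mult_weight {1..n} m)"

text \<open>The difference of order \<theta> multiplies \<open>x powi p\<close> by
  \<open>(x - 1) ^ \<theta>\<close>, exactly the power of \<open>x - 1\<close> gained when the
  number of variables grows by one.\<close>

definition functional :: "(int \<Rightarrow> complex) \<Rightarrow> complex" where
  "functional f = (\<Sum>m\<in>PiE {1..n} narrow. mult_weight {1..n} m
     * divided_diff (nodes k {1..n} m) ((fdiff ^^ Suc k) f))"

lemma functional_diff: "functional (\<lambda>a. f a - g a) = functional f - functional g"
  unfolding functional_def funpow_fdiff_diff divided_diff_diff
  by (simp add: right_diff_distrib sum_subtractf)

text \<open>On every \<open>wide i\<close> the coefficient is a polynomial of degree less than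
  \<theta>, so \<theta> summations by parts leave only values of \<open>f\<close> on the blocks at
  \<open>l (Suc i)\<close> and \<open>l i\<close>.\<close>

lemma functional_vanishes:
  assumes f: "\<And>q. q \<in> nodes k {1..Suc n} l \<Longrightarrow> f q = 0"
  shows "functional f = 0"
proof -
  have "(\<Sum>q\<in>wide i. profile i q * (fdiff ^^ Suc k) f q) = 0" if i: "i \<in> {1..n}" for i
  proof -
    obtain E where E: "E = 0 \<or> degree E < Suc k" "\<And>q. q \<in> wide i \<Longrightarrow> profile i q = poly E (of_int q)"
      using profile_polynomial[OF i] by blast
    have "f q = 0" if q: "q \<in> {l (Suc i)..<l (Suc i) + int (Suc k)} \<union> {l i..<l i + int (Suc k)}" for q
    proof (rule f)
      show "q \<in> nodes k {1..Suc n} l"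
        using q i by (auto simp: nodes_def block_def intro: bexI[of _ i] bexI[of _ "Suc i"])
    qed
    moreover have "l (Suc i) \<le> l i" using gap[OF i] by simp
    ultimately have "(\<Sum>q\<in>{l (Suc i)..<l i}. poly E (of_int q) * (fdiff ^^ Suc k) f q) = 0"
      using E(1) by (intro sum_poly_fdiff_vanishes) auto
    then show ?thesis using E(2) by (simp add: wide_def del: funpow.simps)
  qed
  then show ?thesis unfolding functional_def box_expansion_profile by simp
qed

text \<open>After \<theta> differences the degree is below the number of nodes, so the divided
  difference is a leading coefficient. It is the same for all \<open>m\<close>, and only the total
  weight remains of the sum.\<close>

lemma functional_poly:
  assumes n: "1 \<le> n" and p: "degree p < Suc n * Suc k"
  shows "functional (\<lambda>a. poly p (of_int a))
    = total * (fact (Suc n * Suc k - 1) / fact (n * Suc k - 1)) * coeff p (Suc n * Suc k - 1)"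
proof -
  define d where "d = Suc n * Suc k - 1"
  have d: "d - Suc k = n * Suc k - 1" "Suc k \<le> d"
    using n unfolding d_def by (cases n; simp)+
  have deg: "degree p \<le> d" using p by (simp add: d_def)
  note * = funpow_pdiff_degree[OF deg d(2), unfolded d(1)]
  have "divided_diff (nodes k {1..n} m) ((fdiff ^^ Suc k) (\<lambda>a. poly p (of_int a)))
      = fact d / fact (n * Suc k - 1) * coeff p d" if m: "m \<in> PiE {1..n} narrow" for m
  proof -
    have c: "card (nodes k {1..n} m) = n * Suc k" using card_nodes_narrow[OF _ m] by simp
    have "degree ((pdiff ^^ Suc k) p) < n * Suc k" using * n by (cases n) auto
    then have "divided_diff (nodes k {1..n} m) ((fdiff ^^ Suc k) (\<lambda>a. poly p (of_int a)))
        = coeff ((pdiff ^^ Suc k) p) (n * Suc k - 1)"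
      unfolding funpow_fdiff_poly by (subst divided_diff_poly) (simp_all only: c finite_nodes finite_atLeastAtMost)
    also have "\<dots> = fact d / fact (n * Suc k - 1) * coeff p d"
      using * by (simp add: field_simps)
    finally show ?thesis .
  qed
  then have "functional (\<lambda>a. poly p (of_int a))
      = (\<Sum>m\<in>PiE {1..n} narrow. mult_weight {1..n} m * (fact d / fact (n * Suc k - 1) * coeff p d))"
    unfolding functional_def by (intro sum.cong refl) (simp del: funpow.simps)
  then show ?thesis unfolding total_def sum_distrib_right d_def by (simp only: mult.assoc)
qed

text \<open>By \<open>functional_vanishes\<close>, \<open>f\<close> may be replaced by its
  interpolation polynomial at the blocks of \<open>l\<close>, to which
  \<open>functional_poly\<close> applies.\<close>

theorem functional_eq_divided_diff:
  assumes n: "1 \<le> n"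
  shows "functional f = total * (fact (Suc n * Suc k - 1) / fact (n * Suc k - 1))
    * divided_diff (nodes k {1..Suc n} l) f"
proof -
  let ?S = "nodes k {1..Suc n} l"
  define p where "p = lagrange_poly ?S f"
  have S: "finite ?S" "card ?S = Suc n * Suc k" by (rule finite_nodes, simp) (rule card_nodes_l)
  then have "?S \<noteq> {}" by auto
  then have deg: "degree p < Suc n * Suc k"
    using degree_lagrange_poly[OF S(1)] S(2) by (simp add: p_def)
  have pf: "poly p (of_int q) = f q" if "q \<in> ?S" for q
    using that S(1) by (simp add: p_def poly_lagrange_poly)
  have "functional (\<lambda>a. f a - poly p (of_int a)) = 0"
    by (rule functional_vanishes) (simp add: pf)
  then have "functional f = functional (\<lambda>a. poly p (of_int a))"
    by (simp add: functional_diff)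
  also have "\<dots> = total * (fact (Suc n * Suc k - 1) / fact (n * Suc k - 1)) * coeff p (Suc n * Suc k - 1)"
    by (rule functional_poly[OF n deg])
  also have "coeff p (Suc n * Suc k - 1) = divided_diff ?S (\<lambda>a. poly p (of_int a))"
    using divided_diff_poly[of ?S p] S deg by simp
  also have "\<dots> = divided_diff ?S f"
    by (rule divided_diff_cong[OF pf])
  finally show ?thesis .
qed

end

section \<open>Evaluation of the total weight\<close>

text \<open>This is the Pochhammer symbol \<open>(y - x + 1)_k\<close>, whereas
  \<open>falling k x y\<close> is \<open>(y - x)(y - x - 1)...(y - x - k)\<close>, with
  \<open>k + 1\<close> factors.\<close>

definition rising :: "nat \<Rightarrow> int \<Rightarrow> int \<Rightarrow> complex" where
  "rising k x y = poly (root_poly {x - int k..x - 1}) (of_int y)"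

definition falling :: "nat \<Rightarrow> int \<Rightarrow> int \<Rightarrow> complex" where
  "falling k x y = poly (root_poly (block k x)) (of_int y)"

lemma rising_shift: "rising k (x + c) (y + c) = rising k x y"
proof -
  have "(\<Prod>s\<in>{x + c - int k..x + c - 1}. of_int (y + c - s)) = (\<Prod>s\<in>{x - int k..x - 1}. of_int (y - s) :: complex)"
    by (rule prod.reindex_bij_witness[of _ "\<lambda>s. s + c" "\<lambda>s. s - c"]) auto
  then show ?thesis by (simp add: rising_def poly_root_poly)
qed

lemma rising_nonzero: "x \<le> y \<or> y < x - int k \<Longrightarrow> rising k x y \<noteq> 0"
  by (auto simp: rising_def poly_root_poly)

lemma falling_rising: "falling k x y = (-1) ^ Suc k * (of_int (x - y) * rising k y x)"
proof -
  have b: "block k x = insert x {x + 1..x + int k}" by (auto simp: block_def)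
  have "(\<Prod>s\<in>{x + 1..x + int k}. of_int (y - s) :: complex) = (\<Prod>s\<in>{y - int k..y - 1}. - of_int (x - s))"
    by (rule prod.reindex_bij_witness[of _ "\<lambda>s. x + y - s" "\<lambda>s. x + y - s"]) auto
  also have "\<dots> = (-1) ^ k * (\<Prod>s\<in>{y - int k..y - 1}. of_int (x - s))"
    by (subst prod_uminus) simp
  finally show ?thesis
    unfolding falling_def rising_def poly_root_poly b by (simp add: algebra_simps)
qed

context interlacing
begin

lemma weight_rising: "weight y = (\<Prod>i\<in>{1..Suc n}. rising k (l i) y)"
  by (simp add: weight_poly_def rising_def poly_prod)

lemma root_poly_nodes:
  assumes "finite A" and "\<And>i j. i \<in> A \<Longrightarrow> j \<in> A \<Longrightarrow> i \<noteq> j \<Longrightarrow> block k (m i) \<inter> block k (m j) = {}"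
  shows "poly (root_poly (nodes k A m)) (of_int y) = (\<Prod>j\<in>A. falling k (m j) y)"
  unfolding poly_root_poly nodes_def falling_def using assms
  by (subst prod.UNION_disjoint) auto

end

text \<open>\<open>functional_eq_divided_diff\<close> is tested on the indicator of the lowest node
  \<open>q0\<close>. The left side reduces to the last profile at \<open>q0\<close>, a multiple of
  the total weight with the last coordinate of \<open>l\<close> dropped; the right side reduces to a
  single Lagrange coefficient.\<close>

lemma total_recursion:
  assumes "interlacing k (Suc n) l"
  shows "interlacing.total k (Suc n) l * (fact (Suc (Suc n) * Suc k - 1) / fact (Suc n * Suc k - 1))
    = (-1) ^ (Suc n + Suc n * k) * fact k * interlacing.total k n l
        * (\<Prod>j\<in>{1..Suc n}. rising k (l j) (l (Suc (Suc n))) * falling k (l j) (l (Suc (Suc n))))"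
proof -
  interpret N: interlacing k "Suc n" l by fact
  interpret n: interlacing k n l by unfold_locales (rule N.gap, auto)
  define q0 where "q0 = l (Suc (Suc n))"
  define f :: "int \<Rightarrow> complex" where "f q = (if q = q0 then 1 else 0)" for q
  let ?A = "{1..n}"
  have sets: "{1..Suc n} - {Suc n} = ?A" by auto
  have low: "q0 + int (Suc k) \<le> l j" if "j \<in> {1..Suc n}" for j
    using N.decreasing[of j "Suc (Suc n)"] that unfolding q0_def by auto
  have wide_low: "q0 + int (Suc k) \<le> q" if "q \<in> N.wide j" "j \<in> {1..n}" for q j
    using that low[of "Suc j"] by (auto simp: N.wide_def)
  have narrow_ge: "q0 \<le> q" if "q \<in> N.narrow j" "j \<in> {1..Suc n}" for q j
    using that low[of "Suc j"] by (cases "j = Suc n") (auto simp: N.narrow_def q0_def)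
  have q0_wide: "q0 \<in> N.wide (Suc n)"
    using low[of "Suc n"] by (simp add: N.wide_def q0_def)
  have block_prod: "(\<Prod>s\<in>block k q0 - {q0}. of_int (q0 - s) :: complex) = (-1) ^ k * fact k"
    using prod_diff_interval[of 0 k q0] by (simp add: block_def)

  \<comment> \<open>To the right of \<open>q0\<close> the indicator is zero, so only the term
    \<open>j = 0\<close> of the difference survives.\<close>
  have diff: "(fdiff ^^ Suc k) f q = (-1) ^ Suc k * f q" if "q0 \<le> q" for q
  proof -
    have "(fdiff ^^ Suc k) f q = (\<Sum>j\<le>Suc k. if j = 0 then (-1) ^ Suc k * f q else 0)"
      unfolding funpow_fdiff using that by (intro sum.cong refl) (auto simp: f_def)
    then show ?thesis by simp
  qed
  have "N.functional f = (\<Sum>m\<in>PiE {1..Suc n} N.narrow. N.mult_weight {1..Suc n} m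
      * ((-1) ^ Suc k * divided_diff (nodes k {1..Suc n} m) f))"
    unfolding N.functional_def
  proof (rule sum.cong[OF refl])
    fix m assume m: "m \<in> PiE {1..Suc n} N.narrow"
    have "q0 \<le> q" if "q \<in> nodes k {1..Suc n} m" for q
      using that narrow_ge[OF PiE_mem[OF m]] unfolding nodes_def block_def by fastforce
    then have "divided_diff (nodes k {1..Suc n} m) ((fdiff ^^ Suc k) f)
        = divided_diff (nodes k {1..Suc n} m) (\<lambda>q. (-1) ^ Suc k * f q)"
      by (intro divided_diff_cong diff)
    also have "\<dots> = (-1) ^ Suc k * divided_diff (nodes k {1..Suc n} m) f"
      unfolding divided_diff_def sum_distrib_left by (simp only: times_divide_eq_right)
    finally show "N.mult_weight {1..Suc n} m * divided_diff (nodes k {1..Suc n} m) ((fdiff ^^ Suc k) f)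
      = N.mult_weight {1..Suc n} m * ((-1) ^ Suc k * divided_diff (nodes k {1..Suc n} m) f)" by simp
  qed
  also have "\<dots> = (-1) ^ Suc k * (\<Sum>m\<in>PiE {1..Suc n} N.narrow. N.mult_weight {1..Suc n} m
      * divided_diff (nodes k {1..Suc n} m) f)"
    unfolding sum_distrib_left by (simp only: mult_ac)
  \<comment> \<open>Only the last interval contains \<open>q0\<close>; all others start at
    \<open>q0 + \<theta>\<close> or above.\<close>
  also have "(\<Sum>m\<in>PiE {1..Suc n} N.narrow. N.mult_weight {1..Suc n} m
      * divided_diff (nodes k {1..Suc n} m) f)
    = (\<Sum>i\<in>{1..Suc n}. if i = Suc n then (-1) ^ n * N.profile (Suc n) q0 else 0)"
    unfolding N.box_expansion_profile
  proof (rule sum.cong[OF refl])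
    fix i assume i: "i \<in> {1..Suc n}"
    show "(-1) ^ card {j \<in> {1..Suc n}. j < i} * (\<Sum>q\<in>N.wide i. N.profile i q * f q)
      = (if i = Suc n then (-1) ^ n * N.profile (Suc n) q0 else 0)"
    proof (cases "i = Suc n")
      case True
      have "{j \<in> {1..Suc n}. j < Suc n} = {1..n}" by auto
      moreover have "(\<Sum>q\<in>N.wide (Suc n). N.profile (Suc n) q * f q)
          = (\<Sum>q\<in>N.wide (Suc n). if q = q0 then N.profile (Suc n) q0 else 0)"
        by (rule sum.cong) (auto simp: f_def)
      ultimately show ?thesis using True q0_wide by simp
    next
      case False
      then have "f q = 0" if "q \<in> N.wide i" for q
        using wide_low[OF that] i by (auto simp: f_def)
      then show ?thesis using False by simp
    qed
  qed
  also have "\<dots> = (-1) ^ n * N.profile (Suc n) q0" by simp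
  finally have lhs: "N.functional f = (-1) ^ (Suc k + n) * N.profile (Suc n) q0"
    by (simp add: power_add)

  have weight_step: "N.weight y = n.weight y * rising k q0 y" for y
    unfolding N.weight_rising n.weight_rising q0_def by simp
  have weight_q0: "N.weight q0 = (\<Prod>j\<in>{1..Suc n}. rising k (l j) q0) * fact k"
  proof -
    have "rising k q0 q0 = (\<Prod>s\<in>{q0 - int k..q0 + -1}. of_int (q0 - s))"
      by (simp add: rising_def poly_root_poly)
    also have "\<dots> = (\<Prod>s\<in>{1..k}. of_nat s)"
      by (rule prod.reindex_bij_witness[of _ "\<lambda>s. q0 - int s" "\<lambda>s. nat (q0 - s)"]) auto
    finally have "rising k q0 q0 = fact k" by (simp add: fact_prod)
    then show ?thesis unfolding N.weight_rising q0_def by simp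
  qed
  \<comment> \<open>Of the blocks containing \<open>q0\<close> only the one starting there counts,
    since the weight vanishes at the \<open>k\<close> integers below \<open>q0\<close>.\<close>
  have num: "poly (N.num_poly ?A m) (of_int q0) = N.weight q0 * (\<Prod>j\<in>?A. of_int (q0 - m j)) / ((-1) ^ k * fact k)" for m
  proof -
    have "poly (N.num_poly ?A m) (of_int q0) = (\<Sum>a\<in>{q0 - int k..q0}.
        if a = q0 then N.weight q0 * (\<Prod>j\<in>?A. of_int (q0 - m j)) / ((-1) ^ k * fact k) else 0)"
      unfolding N.poly_num_poly
    proof (rule sum.cong[OF refl])
      fix a assume a: "a \<in> {q0 - int k..q0}"
      have "N.weight a = 0" if "a \<noteq> q0"
        using that a by (intro N.weight_zero[of "Suc (Suc n)"]) (auto simp: q0_def)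
      then show "N.weight a * (\<Prod>j\<in>?A. of_int (a - m j)) / (\<Prod>s\<in>block k a - {q0}. of_int (q0 - s))
        = (if a = q0 then N.weight q0 * (\<Prod>j\<in>?A. of_int (q0 - m j)) / ((-1) ^ k * fact k) else 0)"
        using block_prod by auto
    qed
    then show ?thesis by simp
  qed
  have "N.profile (Suc n) q0 = (\<Sum>m\<in>PiE ?A N.narrow. n.mult_weight ?A m
      * ((-1) ^ (Suc k * n) * (N.weight q0 / ((-1) ^ k * fact k) * (-1) ^ n)))"
    unfolding N.profile_def sets num
  proof (rule sum.cong[OF refl])
    fix m assume m: "m \<in> PiE ?A N.narrow"
    have ne: "falling k (m j) q0 \<noteq> 0" if j: "j \<in> ?A" for j
    proof -
      have "block k (m j) \<subseteq> N.wide j"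
        by (rule N.block_subset_wide[OF PiE_mem[OF m j]])
      then have "q0 \<notin> block k (m j)" using wide_low[of q0 j] j by auto
      then show ?thesis by (auto simp: falling_def poly_root_poly block_def)
    qed
    have root: "poly (root_poly (nodes k ?A m)) (of_int q0) = (\<Prod>j\<in>?A. falling k (m j) q0)"
      by (rule N.root_poly_nodes, simp, rule N.block_narrow_disjoint[OF _ m]) auto
    \<comment> \<open>The additional weight factor \<open>rising k q0 (m j)\<close> times
      \<open>q0 - m j\<close> is, up to sign, \<open>falling k (m j) q0\<close>. It cancels the
      denominator and leaves the weights of the smaller system.\<close>
    have "(\<Prod>j\<in>?A. N.weight (m j)) * (\<Prod>j\<in>?A. of_int (q0 - m j))
      = (\<Prod>j\<in>?A. n.weight (m j) * ((-1) ^ Suc k * falling k (m j) q0) * (- 1))"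
      unfolding prod.distrib[symmetric] weight_step falling_rising
      by (rule prod.cong) (simp_all add: algebra_simps flip: power_add)
    also have "\<dots> = (\<Prod>j\<in>?A. n.weight (m j)) * (-1) ^ (Suc k * n) * (\<Prod>j\<in>?A. falling k (m j) q0) * (-1) ^ n"
      unfolding prod.distrib prod_constant by (simp add: power_mult del: power_Suc mult_Suc)
    finally have "(\<Prod>j\<in>?A. N.weight (m j)) * (\<Prod>j\<in>?A. of_int (q0 - m j)) / (\<Prod>j\<in>?A. falling k (m j) q0)
      = (\<Prod>j\<in>?A. n.weight (m j)) * (-1) ^ (Suc k * n) * (-1) ^ n"
      using ne by simp
    moreover have "N.mult_weight ?A m * (N.weight q0 * (\<Prod>j\<in>?A. of_int (q0 - m j)) / ((-1) ^ k * fact k)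
         / (\<Prod>j\<in>?A. falling k (m j) q0))
      = vandermonde ?A m * ((\<Prod>j\<in>?A. N.weight (m j)) * (\<Prod>j\<in>?A. of_int (q0 - m j)) / (\<Prod>j\<in>?A. falling k (m j) q0))
         * (N.weight q0 / ((-1) ^ k * fact k))"
      by (simp only: times_divide_eq_right times_divide_eq_left divide_divide_eq_left mult_ac)
    ultimately show "N.mult_weight ?A m * (N.weight q0 * (\<Prod>j\<in>?A. of_int (q0 - m j)) / ((-1) ^ k * fact k)
         / poly (root_poly (nodes k ?A m)) (of_int q0))
      = n.mult_weight ?A m * ((-1) ^ (Suc k * n) * (N.weight q0 / ((-1) ^ k * fact k) * (-1) ^ n))"
      unfolding root by (simp only: mult_ac)
  qed
  also have "\<dots> = n.total * ((-1) ^ (Suc k * n) * (N.weight q0 / ((-1) ^ k * fact k) * (-1) ^ n))"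
    unfolding n.total_def sum_distrib_right by simp
  also have "\<dots> = n.total * (-1) ^ (Suc k * n) * (\<Prod>j\<in>{1..Suc n}. rising k (l j) q0) * (-1) ^ n / (-1) ^ k"
    unfolding weight_q0 by simp
  finally have profile: "N.profile (Suc n) q0
    = n.total * (-1) ^ (Suc k * n) * (\<Prod>j\<in>{1..Suc n}. rising k (l j) q0) * (-1) ^ n / (-1) ^ k" .

  let ?S = "nodes k {1..Suc (Suc n)} l"
  have q0_block: "q0 \<in> block k q0" by (simp add: block_def)
  have q0_S: "q0 \<in> ?S"
    using q0_block unfolding nodes_def q0_def by force
  have fall_ne: "falling k (l j) q0 \<noteq> 0" if "j \<in> {1..Suc n}" for j
    using low[OF that] by (auto simp: falling_def poly_root_poly block_def)
  have "{1..Suc (Suc n)} = insert (Suc (Suc n)) {1..Suc n}" by auto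
  then have S_split: "?S = block k q0 \<union> nodes k {1..Suc n} l"
    unfolding nodes_def q0_def by (simp only: UN_insert)
  have S_disj: "block k q0 \<inter> nodes k {1..Suc n} l = {}"
    using low unfolding nodes_def block_def by fastforce
  have "?S - {q0} = (block k q0 - {q0}) \<union> nodes k {1..Suc n} l"
    using S_split S_disj q0_block by blast
  then have "(\<Prod>s\<in>?S - {q0}. of_int (q0 - s) :: complex)
      = (\<Prod>s\<in>block k q0 - {q0}. of_int (q0 - s)) * poly (root_poly (nodes k {1..Suc n} l)) (of_int q0)"
    using S_disj by (simp only:) (subst prod.union_disjoint, auto simp: poly_root_poly)
  also have "\<dots> = (-1) ^ k * fact k * (\<Prod>j\<in>{1..Suc n}. falling k (l j) q0)"
    unfolding block_prod
    by (subst N.root_poly_nodes, simp, rule N.block_l_disjoint) auto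
  finally have S_prod: "(\<Prod>s\<in>?S - {q0}. of_int (q0 - s) :: complex)
    = (-1) ^ k * fact k * (\<Prod>j\<in>{1..Suc n}. falling k (l j) q0)" .
  have "divided_diff ?S f = (\<Sum>p\<in>?S. if p = q0 then 1 / (\<Prod>s\<in>?S - {q0}. of_int (q0 - s)) else 0)"
    unfolding divided_diff_def by (rule sum.cong) (auto simp: f_def)
  also have "\<dots> = 1 / (\<Prod>s\<in>?S - {q0}. of_int (q0 - s))"
    using q0_S by simp
  finally have dd: "divided_diff ?S f = 1 / ((-1) ^ k * fact k * (\<Prod>j\<in>{1..Suc n}. falling k (l j) q0))"
    unfolding S_prod .

  have "N.total * (fact (Suc (Suc n) * Suc k - 1) / fact (Suc n * Suc k - 1)) * divided_diff ?S f
    = (-1) ^ (Suc k + n) * N.profile (Suc n) q0"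
    using N.functional_eq_divided_diff[of f] lhs by simp
  then have main: "N.total * (fact (Suc (Suc n) * Suc k - 1) / fact (Suc n * Suc k - 1))
     = (-1) ^ (Suc k + n) * N.profile (Suc n) q0 * ((-1) ^ k * fact k * (\<Prod>j\<in>{1..Suc n}. falling k (l j) q0))"
    unfolding dd using fall_ne by (simp add: field_simps)
  have sign: "(-1 :: complex) ^ (Suc k + n) * (-1) ^ (Suc k * n) * (-1) ^ n = (-1) ^ (Suc n + Suc n * k)"
    by (simp add: power_add algebra_simps)
  show ?thesis
    unfolding main profile q0_def[symmetric] prod.distrib sign[symmetric] by simp
qed

section \<open>Closed form of the total weight\<close>

definition pair_prod :: "(int \<Rightarrow> int \<Rightarrow> complex) \<Rightarrow> nat \<Rightarrow> (nat \<Rightarrow> int) \<Rightarrow> complex" where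
  "pair_prod F n l = (\<Prod>i\<in>{1..n}. \<Prod>j\<in>{j \<in> {1..n}. i < j}. F (l i) (l j))"

lemma pair_prod_Suc:
  "pair_prod F (Suc n) l = (\<Prod>i\<in>{1..n}. F (l i) (l (Suc n))) * pair_prod F n l"
proof -
  have sets: "{i \<in> {1..Suc n}. i < Suc n} = {1..n}" "{i \<in> {1..Suc n}. Suc n < i} = {}"
    "{1..Suc n} - {Suc n} = {1..n}" and mem: "Suc n \<in> {1..Suc n}" by auto
  show ?thesis
    unfolding pair_prod_def prod_pairs_remove[OF finite_atLeastAtMost mem] sets by simp
qed

text \<open>Each recursion step adds the pairs formed with the new last coordinate. The constant
  stays implicit: it is independent of \<open>l\<close> and nonzero, so it cancels in the Jack
  character.\<close>

lemma total_closed_form: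
  "\<exists>c. c \<noteq> 0 \<and> (\<forall>l. interlacing k n l \<longrightarrow>
     interlacing.total k n l = c * pair_prod (\<lambda>x y. rising k x y * falling k x y) (Suc n) l)"
proof (induction n)
  case 0
  have "interlacing.total k 0 l = 1 * pair_prod (\<lambda>x y. rising k x y * falling k x y) (Suc 0) l"
    if "interlacing k 0 l" for l
  proof -
    have none: "{j. j = Suc 0 \<and> Suc 0 < j} = {}" by auto
    show ?thesis
      unfolding interlacing.total_def[OF that] by (simp add: pair_prod_def vandermonde_def none)
  qed
  then show ?case by (intro exI[of _ 1]) simp
next
  case (Suc n)
  then obtain c where c: "c \<noteq> 0" "\<And>l. interlacing k n l \<Longrightarrow>
     interlacing.total k n l = c * pair_prod (\<lambda>x y. rising k x y * falling k x y) (Suc n) l"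
    by blast
  define r :: complex where "r = fact (Suc (Suc n) * Suc k - 1) / fact (Suc n * Suc k - 1)"
  define d where "d = (-1) ^ (Suc n + Suc n * k) * fact k * c / r"
  have r: "r \<noteq> 0" unfolding r_def by (simp only: divide_eq_0_iff fact_nonzero) simp
  show ?case
  proof (intro exI[of _ d] conjI allI impI)
    show "d \<noteq> 0" using c r by (simp add: d_def)
    fix l assume l: "interlacing k (Suc n) l"
    then have "interlacing k n l" by (simp add: interlacing_def)
    from total_recursion[OF l] r c(2)[OF this]
    show "interlacing.total k (Suc n) l
        = d * pair_prod (\<lambda>x y. rising k x y * falling k x y) (Suc (Suc n)) l"
      unfolding r_def[symmetric] pair_prod_Suc[of _ "Suc n"] d_def by (simp add: field_simps)
  qed
qed

section \<open>Branching coefficients\<close>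

lemma of_real_pochhammer: "complex_of_real (pochhammer (of_int (y - x) + 1) k) = rising k x y"
proof -
  have "rising k 0 (y - x) = (\<Prod>s\<in>{0 - int k..0 - 1}. of_int (y - x - s))"
    by (simp add: rising_def poly_root_poly)
  also have "\<dots> = (\<Prod>i\<in>{0..<k}. of_int (y - x + 1 + int i))"
    by (rule prod.reindex_bij_witness[of _ "\<lambda>i. - 1 - int i" "\<lambda>s. nat (- 1 - s)"]) auto
  also have "\<dots> = complex_of_real (\<Prod>i\<in>{0..<k}. of_int (y - x) + 1 + of_nat i)"
    by simp
  also have "\<dots> = complex_of_real (pochhammer (of_int (y - x) + 1) k)"
    by (simp only: pochhammer_prod)
  finally show ?thesis
    using rising_shift[of k 0 x "y - x"] by simp
qed

lemma rising_reflect: "rising k x (y - int (Suc k)) = (-1) ^ k * rising k y x"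
proof -
  have "(\<Prod>s\<in>{x - int k..x - 1}. of_int (y - int (Suc k) - s)) = (\<Prod>s\<in>{y - int k..y - 1}. - of_int (x - s) :: complex)"
    by (rule prod.reindex_bij_witness[of _ "\<lambda>s. x + y - int (Suc k) - s" "\<lambda>s. x + y - int (Suc k) - s"]) auto
  also have "\<dots> = (-1) ^ k * (\<Prod>s\<in>{y - int k..y - 1}. of_int (x - s))"
    by (subst prod_uminus) simp
  finally show ?thesis by (simp add: rising_def poly_root_poly)
qed

text \<open>\<open>(a + 1)_(\<nu> + k)\<close> splits in two ways. For integral \<theta> this trades
  the length \<open>\<nu>\<close>, which varies with the signatures, for the fixed length
  \<open>k\<close>.\<close>

lemma pochhammer_ratio:
  fixes a :: real
  assumes "0 \<le> a"
  shows "pochhammer (a + real (Suc k)) \<nu> / pochhammer (a + 1) \<nu> = pochhammer (a + real \<nu> + 1) k / pochhammer (a + 1) k"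
proof -
  have "pochhammer (a + 1) \<nu> * pochhammer (a + 1 + real \<nu>) k = pochhammer (a + 1) k * pochhammer (a + 1 + real k) \<nu>"
    by (simp only: pochhammer_product'[symmetric] add.commute[of \<nu> k])
  moreover have "pochhammer (a + 1) \<nu> > 0" "pochhammer (a + 1) k > 0"
    using assms by (auto intro!: pochhammer_pos)
  ultimately show ?thesis by (simp add: field_simps)
qed

text \<open>Applied with \<open>a = m i\<close>, \<open>b = m j\<close>,
  \<open>c = l (Suc j)\<close>, \<open>d = l i\<close>. The two signs from
  \<open>rising_reflect\<close> cancel.\<close>

lemma psi_factor:
  fixes a b c d :: int and t :: nat
  assumes "b \<le> a" and "c \<le> b" and "b + int (Suc k) \<le> d"
  shows "complex_of_real (pochhammer (of_int (a - b) + real (Suc k)) (nat (b - c)) / pochhammer (of_int (a - b) + 1) (nat (b - c))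
      * (pochhammer (of_int (d - b - int (Suc k)) + 1) (nat (b - c))
         / pochhammer (of_int (d - b - int (Suc k)) + real (Suc k)) (nat (b - c))))
    = rising k c a * rising k d b / (rising k b a * rising k d c)"
proof -
  define A B where "A = real_of_int (a - b)" and "B = real_of_int (d - b - int (Suc k))"
  define \<nu> where "\<nu> = nat (b - c)"
  have nonneg: "0 \<le> A" "0 \<le> B" using assms by (simp_all add: A_def B_def)
  have e: "A + real \<nu> = of_int (a - c)" "B + real \<nu> = of_int (d - int (Suc k) - c)"
    using assms by (simp_all add: A_def B_def \<nu>_def)
  have "pochhammer (B + 1) \<nu> / pochhammer (B + real (Suc k)) \<nu> = pochhammer (B + 1) k / pochhammer (B + real \<nu> + 1) k"
    using pochhammer_ratio[OF nonneg(2), of k \<nu>] by (metis inverse_divide)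
  then have "complex_of_real (pochhammer (A + real (Suc k)) \<nu> / pochhammer (A + 1) \<nu>
      * (pochhammer (B + 1) \<nu> / pochhammer (B + real (Suc k)) \<nu>))
    = complex_of_real (pochhammer (of_int (a - c) + 1) k) / complex_of_real (pochhammer (of_int (a - b) + 1) k)
      * (complex_of_real (pochhammer (of_int (d - int (Suc k) - b) + 1) k)
         / complex_of_real (pochhammer (of_int (d - int (Suc k) - c) + 1) k))"
    unfolding pochhammer_ratio[OF nonneg(1)] e by (simp add: A_def B_def algebra_simps)
  also have "\<dots> = rising k c a / rising k b a * (rising k b (d - int (Suc k)) / rising k c (d - int (Suc k)))"
    unfolding of_real_pochhammer ..
  also have "\<dots> = rising k c a * rising k d b / (rising k b a * rising k d c)"
    unfolding rising_reflect by simp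
  finally show ?thesis unfolding A_def B_def \<nu>_def .
qed

section \<open>Interlacing signatures in shifted coordinates\<close>

definition shifted :: "nat \<Rightarrow> nat \<Rightarrow> (nat \<Rightarrow> int) \<Rightarrow> nat \<Rightarrow> int" where
  "shifted k n lam i = lam i + int (Suc k * (n - i))"

lemma signatures_antimono:
  "lam \<in> signatures n \<Longrightarrow> 1 \<le> i \<Longrightarrow> i \<le> j \<Longrightarrow> j \<le> n \<Longrightarrow> lam j \<le> lam i"
  by (auto simp: signatures_def)

lemma interlacing_shifted:
  assumes "lam \<in> signatures (Suc n)"
  shows "interlacing k n (shifted k (Suc n) lam)"
proof
  fix i assume i: "i \<in> {1..n}"
  then have "lam (Suc i) \<le> lam i" by (intro signatures_antimono[OF assms]) auto
  moreover have "Suc n - i = Suc (n - i)" "Suc n - Suc i = n - i" using i by auto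
  ultimately show "shifted k (Suc n) lam (Suc i) + int (Suc k) \<le> shifted k (Suc n) lam i"
    by (simp add: shifted_def)
qed

text \<open>Interlacing already forces \<open>mu\<close> to be weakly decreasing and nonnegative, so
  the coordinates range independently over a box.\<close>

lemma interlaces_eq_PiE:
  assumes lam: "lam \<in> signatures_nonneg (Suc n)" and n: "1 \<le> n"
  shows "{mu \<in> signatures_nonneg n. interlaces n mu lam} = PiE {1..n} (\<lambda>i. {lam (i + 1)..lam i})"
proof (intro equalityI subsetI)
  fix mu assume "mu \<in> {mu \<in> signatures_nonneg n. interlaces n mu lam}"
  then show "mu \<in> PiE {1..n} (\<lambda>i. {lam (i + 1)..lam i})"
    by (auto simp: signatures_nonneg_def signatures_def interlaces_def PiE_iff)
next
  fix mu assume mu: "mu \<in> PiE {1..n} (\<lambda>i. {lam (i + 1)..lam i})"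
  have sig: "lam \<in> signatures (Suc n)" and pos: "0 \<le> lam (Suc n)"
    using lam by (auto simp: signatures_nonneg_def)
  have b: "lam (i + 1) \<le> mu i" "mu i \<le> lam i" if "i \<in> {1..n}" for i
    using PiE_mem[OF mu that] by auto
  have "mu j \<le> mu i" if "i \<in> {1..n}" "j \<in> {1..n}" "i \<le> j" for i j
  proof (cases "i = j")
    case False
    then have "lam j \<le> lam (i + 1)" using that by (intro signatures_antimono[OF sig]) auto
    then show ?thesis using b(1)[OF that(1)] b(2)[OF that(2)] by linarith
  qed simp
  moreover have "0 \<le> mu n" using b(1)[of n] pos n by simp
  ultimately show "mu \<in> {mu \<in> signatures_nonneg n. interlaces n mu lam}"
    using mu b by (auto simp: signatures_nonneg_def signatures_def interlaces_def PiE_iff)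
qed

text \<open>Change of variables from \<open>mu\<close> to shifted coordinates;
  \<open>restrict\<close> is there because members of the box have to be extensional.\<close>

lemma sum_interlacing:
  assumes lam: "lam \<in> signatures_nonneg (Suc n)" and n: "1 \<le> n"
    and G: "\<And>mu. mu \<in> PiE {1..n} (\<lambda>i. {lam (i + 1)..lam i}) \<Longrightarrow> G mu = H (restrict (shifted k n mu) {1..n})"
  shows "(\<Sum>mu\<in>{mu \<in> signatures_nonneg n. interlaces n mu lam}. G mu)
    = (\<Sum>m\<in>PiE {1..n} (interlacing.narrow k (shifted k (Suc n) lam)). H m)"
  unfolding interlaces_eq_PiE[OF lam n]
proof (rule sum.reindex_bij_witness[of _ "\<lambda>m. \<lambda>i\<in>{1..n}. m i - int (Suc k * (n - i))"
      "\<lambda>mu. restrict (shifted k n mu) {1..n}"])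
  interpret interlacing k n "shifted k (Suc n) lam"
    using lam by (intro interlacing_shifted) (simp add: signatures_nonneg_def)
  have narrow: "narrow i = {lam (i + 1) + int (Suc k * (n - i))..lam i + int (Suc k * (n - i))}"
    if "i \<in> {1..n}" for i
  proof -
    have "Suc n - i = Suc (n - i)" "Suc n - Suc i = n - i" using that by auto
    then show ?thesis by (simp add: narrow_def shifted_def)
  qed
  fix mu assume mu: "mu \<in> PiE {1..n} (\<lambda>i. {lam (i + 1)..lam i})"
  then show "(\<lambda>i\<in>{1..n}. restrict (shifted k n mu) {1..n} i - int (Suc k * (n - i))) = mu"
    by (auto simp: fun_eq_iff shifted_def PiE_iff extensional_def)
  show "restrict (shifted k n mu) {1..n} \<in> PiE {1..n} narrow"
    using mu by (auto simp: narrow shifted_def PiE_iff simp del: of_nat_mult)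
  show "H (restrict (shifted k n mu) {1..n}) = G mu" using G[OF mu] by simp
next
  interpret interlacing k n "shifted k (Suc n) lam"
    using lam by (intro interlacing_shifted) (simp add: signatures_nonneg_def)
  have narrow: "narrow i = {lam (i + 1) + int (Suc k * (n - i))..lam i + int (Suc k * (n - i))}"
    if "i \<in> {1..n}" for i
  proof -
    have "Suc n - i = Suc (n - i)" "Suc n - Suc i = n - i" using that by auto
    then show ?thesis by (simp add: narrow_def shifted_def)
  qed
  fix m assume m: "m \<in> PiE {1..n} narrow"
  then show "restrict (shifted k n (\<lambda>i\<in>{1..n}. m i - int (Suc k * (n - i)))) {1..n} = m"
    by (auto simp: fun_eq_iff shifted_def PiE_iff extensional_def)
  show "(\<lambda>i\<in>{1..n}. m i - int (Suc k * (n - i))) \<in> PiE {1..n} (\<lambda>i. {lam (i + 1)..lam i})"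
  proof (intro restrict_PiE_iff[THEN iffD2] ballI)
    fix i assume i: "i \<in> {1..n}"
    show "m i - int (Suc k * (n - i)) \<in> {lam (i + 1)..lam i}"
      using PiE_mem[OF m i] unfolding narrow[OF i] by simp
  qed
qed

lemma jack_psi_eq:
  fixes k n :: nat
  assumes lam: "lam \<in> signatures (Suc n)" and mu: "mu \<in> PiE {1..n} (\<lambda>i. {lam (i + 1)..lam i})"
  defines "l \<equiv> shifted k (Suc n) lam" and "m \<equiv> shifted k n mu"
  shows "complex_of_real (jack_psi (real (Suc k)) n lam mu) =
    (\<Prod>i=1..n. \<Prod>j=i..n. rising k (l (Suc j)) (m i) * rising k (l i) (m j)
       / (rising k (m j) (m i) * rising k (l i) (l (Suc j))))"
  unfolding jack_psi_def Let_def of_real_prod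
proof (intro prod.cong refl)
  fix i j assume i: "i \<in> {1..n}" and j: "j \<in> {i..n}"
  have b: "lam (i + 1) \<le> mu i" "mu i \<le> lam i" if "i \<in> {1..n}" for i
    using PiE_mem[OF mu that] by auto
  have ij: "int (n - i) = int (j - i) + int (n - j)" "Suc n - i = Suc (n - i)" "Suc n - Suc j = n - j"
    using i j by auto
  have mono: "mu j \<le> mu i"
  proof (cases "i = j")
    case False
    then have "lam j \<le> lam (i + 1)" using i j by (intro signatures_antimono[OF lam]) auto
    then show ?thesis using b(1)[OF i] b(2)[of j] i j by simp
  qed simp
  have "mu j \<le> lam i"
    using mono b(2)[OF i] by linarith
  have mij: "m i - m j = mu i - mu j + int (Suc k) * int (j - i)"
    unfolding m_def shifted_def of_nat_mult ij(1) by (simp only: distrib_left)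
  have lmij: "l i - m j - int (Suc k) = lam i - mu j + int (Suc k) * int (j - i)"
    unfolding l_def m_def shifted_def of_nat_mult ij(2) of_nat_Suc[of "n - i"] ij(1)
    by (simp add: algebra_simps)
  have mlj: "m j - l (Suc j) = mu j - lam (j + 1)"
    unfolding l_def m_def shifted_def ij(3) by simp
  have nonneg: "0 \<le> int (Suc k) * int (j - i)" by (intro mult_nonneg_nonneg) simp_all
  have "m j \<le> m i" using mij mono nonneg by linarith
  moreover have "l (Suc j) \<le> m j" using mlj b(1)[of j] i j by simp
  moreover have "m j + int (Suc k) \<le> l i" using lmij \<open>mu j \<le> lam i\<close> nonneg by linarith
  ultimately have "complex_of_real (pochhammer (of_int (m i - m j) + real (Suc k)) (nat (m j - l (Suc j)))
        / pochhammer (of_int (m i - m j) + 1) (nat (m j - l (Suc j)))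
      * (pochhammer (of_int (l i - m j - int (Suc k)) + 1) (nat (m j - l (Suc j)))
         / pochhammer (of_int (l i - m j - int (Suc k)) + real (Suc k)) (nat (m j - l (Suc j)))))
    = rising k (l (Suc j)) (m i) * rising k (l i) (m j) / (rising k (m j) (m i) * rising k (l i) (l (Suc j)))"
    by (intro psi_factor)
  then show "complex_of_real
        (pochhammer (of_int (mu i - mu j) + real (Suc k) * real (j - i) + real (Suc k)) (nat (mu j - lam (j + 1)))
        / pochhammer (of_int (mu i - mu j) + real (Suc k) * real (j - i) + 1) (nat (mu j - lam (j + 1)))
        * (pochhammer (of_int (lam i - mu j) + real (Suc k) * real (j - i) + 1) (nat (mu j - lam (j + 1)))
         / pochhammer (of_int (lam i - mu j) + real (Suc k) * real (j - i) + real (Suc k)) (nat (mu j - lam (j + 1)))))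
    = rising k (l (Suc j)) (m i) * rising k (l i) (m j) / (rising k (m j) (m i) * rising k (l i) (l (Suc j)))"
    unfolding mij lmij mlj of_int_add of_int_mult of_int_of_nat_eq .
qed

text \<open>By induction, \<open>pair_prod (falling k) n m\<close> is J_mu(1, ..., 1) up to a
  constant, so the left side is what the branching sum averages. The factors outside the last
  bracket do not depend on \<open>mu\<close>; \<open>rising k 0 0\<close> is k!.\<close>

lemma jack_psi_weight:
  fixes k n :: nat
  assumes lam: "lam \<in> signatures (Suc n)" and mu: "mu \<in> PiE {1..n} (\<lambda>i. {lam (i + 1)..lam i})"
  defines "l \<equiv> shifted k (Suc n) lam" and "m \<equiv> restrict (shifted k n mu) {1..n}"
  shows "complex_of_real (jack_psi (real (Suc k)) n lam mu) * pair_prod (falling k) n m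
    = pair_prod (\<lambda>_ _. (-1) ^ Suc k) n (\<lambda>_. 0) / rising k 0 0 ^ n / pair_prod (rising k) (Suc n) l
      * (vandermonde {1..n} m * (\<Prod>i\<in>{1..n}. poly (interlacing.weight_poly k n l) (of_int (m i))))"
proof -
  interpret interlacing k n l
    unfolding l_def by (rule interlacing_shifted[OF lam])
  have m: "m i = shifted k n mu i" if "i \<in> {1..n}" for i
    using that by (simp add: m_def)
  have later: "{j \<in> {1..n}. i < j} = {Suc i..n}" if "i \<in> {1..n}" for i using that by auto
  have rising_refl: "rising k x x = rising k 0 0" for x
    using rising_shift[of k 0 x 0] by simp
  have b: "lam (i + 1) \<le> mu i" "mu i \<le> lam i" if "i \<in> {1..n}" for i
    using PiE_mem[OF mu that] by auto
  have m_mono: "m j \<le> m i" if ij: "i \<in> {1..n}" "j \<in> {Suc i..n}" for i j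
  proof -
    have "lam j \<le> lam (i + 1)" using ij by (intro signatures_antimono[OF lam]) auto
    then have "mu j \<le> mu i" using b(1)[OF ij(1)] b(2)[of j] ij by simp
    moreover have "int (Suc k * (n - j)) \<le> int (Suc k * (n - i))"
      using ij by (intro of_nat_mono mult_le_mono2) auto
    ultimately show ?thesis using ij by (simp add: m shifted_def del: of_nat_mult)
  qed

  let ?X3 = "\<Prod>i=1..n. \<Prod>j\<in>{Suc i..n}. rising k (m j) (m i)"
  have "?X3 \<noteq> 0"
    using m_mono by (auto intro!: rising_nonzero)
  \<comment> \<open>The first product meets \<open>m i\<close> with
    \<open>l (i + 1), ..., l (n + 1)\<close>, the second, after swapping, with
    \<open>l 1, ..., l i\<close>; together all factors of the weight appear.\<close>
  have X12: "(\<Prod>i=1..n. \<Prod>j=i..n. rising k (l (Suc j)) (m i)) * (\<Prod>i=1..n. \<Prod>j=i..n. rising k (l i) (m j))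
    = (\<Prod>i\<in>{1..n}. weight (m i))"
  proof -
    have "(\<Prod>i=1..n. \<Prod>j=i..n. rising k (l i) (m j)) = (\<Prod>i=1..n. \<Prod>j\<in>{j \<in> {1..n}. i \<le> j}. rising k (l i) (m j))"
      by (intro prod.cong refl) auto
    also have "\<dots> = (\<Prod>j=1..n. \<Prod>i\<in>{i \<in> {1..n}. i \<le> j}. rising k (l i) (m j))"
      by (rule prod.swap_restrict) auto
    finally have swap: "(\<Prod>i=1..n. \<Prod>j=i..n. rising k (l i) (m j))
        = (\<Prod>j=1..n. \<Prod>i\<in>{i \<in> {1..n}. i \<le> j}. rising k (l i) (m j))" .
    show ?thesis
      unfolding swap prod.distrib[symmetric] weight_rising
    proof (rule prod.cong[OF refl])
      fix i assume i: "i \<in> {1..n}"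
      have "{1..Suc n} = {j \<in> {1..n}. j \<le> i} \<union> {Suc i..Suc n}" using i by auto
      then have "(\<Prod>j\<in>{1..Suc n}. rising k (l j) (m i))
         = (\<Prod>j\<in>{j \<in> {1..n}. j \<le> i}. rising k (l j) (m i)) * (\<Prod>j\<in>{Suc i..Suc n}. rising k (l j) (m i))"
        by (simp only:) (rule prod.union_disjoint, auto)
      then show "(\<Prod>j=i..n. rising k (l (Suc j)) (m i)) * (\<Prod>j\<in>{j \<in> {1..n}. j \<le> i}. rising k (l j) (m i))
          = (\<Prod>j\<in>{1..Suc n}. rising k (l j) (m i))"
        by (simp only: prod.shift_bounds_cl_Suc_ivl mult.commute)
    qed
  qed
  have X3: "(\<Prod>i=1..n. \<Prod>j=i..n. rising k (m j) (m i)) = rising k 0 0 ^ n * ?X3"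
  proof -
    have "(\<Prod>i=1..n. \<Prod>j=i..n. rising k (m j) (m i)) = (\<Prod>i=1..n. rising k 0 0 * (\<Prod>j\<in>{Suc i..n}. rising k (m j) (m i)))"
    proof (rule prod.cong[OF refl])
      fix i assume "i \<in> {1..n}"
      then have "{i..n} = insert i {Suc i..n}" by auto
      then show "(\<Prod>j=i..n. rising k (m j) (m i)) = rising k 0 0 * (\<Prod>j\<in>{Suc i..n}. rising k (m j) (m i))"
        by (simp add: rising_refl[of "m i"])
    qed
    then show ?thesis by (simp add: prod.distrib)
  qed
  have X4: "(\<Prod>i=1..n. \<Prod>j=i..n. rising k (l i) (l (Suc j))) = pair_prod (rising k) (Suc n) l"
  proof -
    have "pair_prod (rising k) (Suc n) l = (\<Prod>i\<in>{1..Suc n}. \<Prod>j\<in>{Suc i..Suc n}. rising k (l i) (l j))"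
      unfolding pair_prod_def by (intro prod.cong refl) auto
    also have "\<dots> = (\<Prod>i\<in>{1..n}. \<Prod>j\<in>{Suc i..Suc n}. rising k (l i) (l j))"
      by simp
    finally show ?thesis by (simp only: prod.shift_bounds_cl_Suc_ivl)
  qed
  \<comment> \<open>\<open>falling_rising\<close> turns each factor into a sign, a difference and a
    \<open>rising\<close> factor; the last kind cancels the off-diagonal denominators of the
    branching coefficient.\<close>
  have F: "pair_prod (falling k) n m = pair_prod (\<lambda>_ _. (-1) ^ Suc k) n (\<lambda>_. 0) * vandermonde {1..n} m * ?X3"
    unfolding pair_prod_def vandermonde_def prod.distrib[symmetric] falling_rising
    by (intro prod.cong refl) (simp only: prod.distrib later mult.assoc)
  have "complex_of_real (jack_psi (real (Suc k)) n lam mu) =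
    (\<Prod>i=1..n. \<Prod>j=i..n. rising k (l (Suc j)) (m i) * rising k (l i) (m j)
       / (rising k (m j) (m i) * rising k (l i) (l (Suc j))))"
    unfolding jack_psi_eq[OF lam mu] l_def
    by (intro prod.cong refl) (simp add: m)
  also have "\<dots> = (\<Prod>i\<in>{1..n}. weight (m i)) / (rising k 0 0 ^ n * ?X3 * pair_prod (rising k) (Suc n) l)"
    unfolding X12[symmetric] X3[symmetric] X4[symmetric] by (simp only: prod.distrib prod_dividef)
  finally show ?thesis unfolding F using \<open>?X3 \<noteq> 0\<close> by simp
qed

section \<open>Induction along the branching rule\<close>

lemma funpow_fdiff_power:
  assumes "x \<noteq> 0"
  shows "(fdiff ^^ k) (\<lambda>p. x powi p) = (\<lambda>p. (x - 1) ^ k * x powi p)"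
  by (induction k) (use assms in \<open>simp_all add: fdiff_def fun_eq_iff power_int_add algebra_simps\<close>)

lemma pair_prod_cong: "(\<And>i. i \<in> {1..n} \<Longrightarrow> l i = l' i) \<Longrightarrow> pair_prod F n l = pair_prod F n l'"
  unfolding pair_prod_def by (intro prod.cong refl) auto

lemma divided_diff_cmult: "divided_diff S (\<lambda>q. c * f q) = c * divided_diff S f"
  unfolding divided_diff_def sum_distrib_left by (simp only: times_divide_eq_right)

abbreviation jack_value :: "nat \<Rightarrow> nat \<Rightarrow> (nat \<Rightarrow> int) \<Rightarrow> complex \<Rightarrow> complex" where
  "jack_value k n lam x \<equiv> jack_nonneg (real (Suc k)) n lam (\<lambda>i. if i \<le> 1 then x else 1)"

text \<open>The free variable is the first one, so branching removes a variable equal to 1 and its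
  power disappears.\<close>

lemma jack_value_Suc:
  assumes "1 \<le> n"
  shows "jack_value k (Suc n) lam x = (\<Sum>mu\<in>{mu \<in> signatures_nonneg n. interlaces n mu lam}.
     complex_of_real (jack_psi (real (Suc k)) n lam mu) * jack_value k n mu x)"
  using assms by (cases n) simp_all

text \<open>Both formulas share the same \<open>c\<close>, which therefore cancels in the quotient.
  In the step, \<open>jack_psi_weight\<close> rewrites the branching sums: at 1 they give
  \<open>total\<close>, at \<open>x\<close> they give \<open>functional\<close> of
  \<open>x powi p\<close>.\<close>

theorem jack_value_divided_diff:
  assumes "1 \<le> n"
  shows "\<exists>c. c \<noteq> 0 \<and> (\<forall>lam\<in>signatures_nonneg n.
     jack_value k n lam 1 = c * pair_prod (falling k) n (shifted k n lam) \<and>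
     (\<forall>x. x \<noteq> 0 \<longrightarrow> (x - 1) ^ (n * Suc k - 1) * jack_value k n lam x
        = fact (n * Suc k - 1) * c * pair_prod (falling k) n (shifted k n lam)
          * divided_diff (nodes k {1..n} (shifted k n lam)) (\<lambda>p. x powi p)))"
  using assms
proof (induction n rule: dec_induct)
  case base
  show ?case
  proof (intro exI[of _ 1] conjI ballI allI impI)
    fix lam assume lam: "lam \<in> signatures_nonneg 1"
    have none: "{j. j = Suc 0 \<and> Suc 0 < j} = {}" by auto
    have Y: "pair_prod (falling k) 1 (shifted k 1 lam) = 1"
      by (simp add: pair_prod_def none)
    show "jack_value k 1 lam 1 = 1 * pair_prod (falling k) 1 (shifted k 1 lam)"
      unfolding Y by simp
    fix x :: complex assume x: "x \<noteq> 0"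
    have "nodes k {1..1} (shifted k 1 lam) = {lam 1..lam 1 + int k}"
      by (simp add: nodes_def block_def shifted_def)
    then have "divided_diff (nodes k {1..1} (shifted k 1 lam)) (\<lambda>p. x powi p) = (x - 1) ^ k * x powi lam 1 / fact k"
      by (simp only: divided_diff_consecutive funpow_fdiff_power[OF x])
    moreover have "x ^ nat (lam 1) = x powi lam 1"
      using lam by (simp add: signatures_nonneg_def power_int_def)
    ultimately show "(x - 1) ^ (1 * Suc k - 1) * jack_value k 1 lam x
        = fact (1 * Suc k - 1) * 1 * pair_prod (falling k) 1 (shifted k 1 lam)
          * divided_diff (nodes k {1..1} (shifted k 1 lam)) (\<lambda>p. x powi p)"
      unfolding Y by simp
  qed simp
next
  case (step n)
  then obtain c where c: "c \<noteq> 0" and IH: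
    "\<And>lam. lam \<in> signatures_nonneg n \<Longrightarrow> jack_value k n lam 1 = c * pair_prod (falling k) n (shifted k n lam)"
    "\<And>lam x. lam \<in> signatures_nonneg n \<Longrightarrow> x \<noteq> 0 \<Longrightarrow> (x - 1) ^ (n * Suc k - 1) * jack_value k n lam x
        = fact (n * Suc k - 1) * c * pair_prod (falling k) n (shifted k n lam)
          * divided_diff (nodes k {1..n} (shifted k n lam)) (\<lambda>p. x powi p)"
    by blast
  obtain c' where c': "c' \<noteq> 0" and total: "\<And>l. interlacing k n l \<Longrightarrow>
     interlacing.total k n l = c' * pair_prod (\<lambda>x y. rising k x y * falling k x y) (Suc n) l"
    using total_closed_form by blast
  define e where "e = pair_prod (\<lambda>_ _. (-1) ^ Suc k) n (\<lambda>_. 0) / rising k 0 0 ^ n"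
  have e: "e \<noteq> 0"
    using rising_nonzero[of 0 0 k] by (simp add: e_def pair_prod_def)
  show ?case
  proof (intro exI[of _ "c * e * c'"] conjI ballI allI impI)
    show "c * e * c' \<noteq> 0" using c c' e by simp
    fix lam assume lam: "lam \<in> signatures_nonneg (Suc n)"
    define l where "l = shifted k (Suc n) lam"
    define Y where "Y = pair_prod (rising k) (Suc n) l"
    have sig: "lam \<in> signatures (Suc n)" using lam by (simp add: signatures_nonneg_def)
    interpret interlacing k n l
      unfolding l_def by (rule interlacing_shifted[OF sig])
    have "rising k (l i) (l j) \<noteq> 0" if "i \<in> {1..Suc n}" "j \<in> {1..Suc n}" "i < j" for i j
    proof -
      have "l j + int (Suc k) \<le> l i" using decreasing[of i j] that by simp
      then show ?thesis by (intro rising_nonzero) linarith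
    qed
    then have Y: "Y \<noteq> 0"
      unfolding Y_def pair_prod_def by simp
    \<comment> \<open>The \<open>rising\<close> half of the closed form of the total weight cancels
      the denominator \<open>Y\<close> of the branching coefficients.\<close>
    have total_Y: "total / Y = c' * pair_prod (falling k) (Suc n) l"
    proof -
      have "total = c' * (Y * pair_prod (falling k) (Suc n) l)"
        unfolding total[OF interlacing_axioms] Y_def pair_prod_def by (simp only: prod.distrib)
      then show ?thesis using Y by simp
    qed
    have weights: "complex_of_real (jack_psi (real (Suc k)) n lam mu) * pair_prod (falling k) n (shifted k n mu)
        = e / Y * mult_weight {1..n} (restrict (shifted k n mu) {1..n})"
      if "mu \<in> PiE {1..n} (\<lambda>i. {lam (i + 1)..lam i})" for mu
    proof -
      have "pair_prod (falling k) n (shifted k n mu) = pair_prod (falling k) n (restrict (shifted k n mu) {1..n})"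
        by (rule pair_prod_cong) simp
      then show ?thesis using jack_psi_weight[OF sig that] by (simp add: e_def Y_def l_def)
    qed
    have nonneg: "mu \<in> signatures_nonneg n" if "mu \<in> PiE {1..n} (\<lambda>i. {lam (i + 1)..lam i})" for mu
      using that interlaces_eq_PiE[OF lam] step by blast

    have "jack_value k (Suc n) lam 1 = (\<Sum>m\<in>PiE {1..n} narrow. c * (e / Y * mult_weight {1..n} m))"
      unfolding jack_value_Suc[OF step(1)]
    proof (rule sum_interlacing[where lam = lam and n = n and k = k, folded l_def, OF lam step(1)])
      fix mu assume mu: "mu \<in> PiE {1..n} (\<lambda>i. {lam (i + 1)..lam i})"
      show "complex_of_real (jack_psi (real (Suc k)) n lam mu) * jack_value k n mu 1
          = c * (e / Y * mult_weight {1..n} (restrict (shifted k n mu) {1..n}))"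
        unfolding weights[OF mu, symmetric] IH(1)[OF nonneg[OF mu]] by (simp only: mult_ac)
    qed
    also have "\<dots> = c * e * (total / Y)"
      unfolding total_def by (simp add: sum_distrib_left sum_divide_distrib mult_ac)
    finally show "jack_value k (Suc n) lam 1 = c * e * c' * pair_prod (falling k) (Suc n) (shifted k (Suc n) lam)"
      unfolding total_Y by (simp add: l_def)

    fix x :: complex assume x: "x \<noteq> 0"
    \<comment> \<open>The \<theta> additional factors \<open>x - 1\<close> are moved into the
      divided difference as a difference of order \<theta>.\<close>
    have exponent: "Suc n * Suc k - 1 = Suc k + (n * Suc k - 1)" using step(1) by (cases n) auto
    have "(x - 1) ^ (Suc n * Suc k - 1) * jack_value k (Suc n) lam x
      = (\<Sum>mu\<in>{mu \<in> signatures_nonneg n. interlaces n mu lam}.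
          complex_of_real (jack_psi (real (Suc k)) n lam mu) * (x - 1) ^ Suc k
            * ((x - 1) ^ (n * Suc k - 1) * jack_value k n mu x))"
      unfolding jack_value_Suc[OF step(1)] exponent power_add sum_distrib_left
      by (simp only: mult_ac)
    also have "\<dots> = (\<Sum>m\<in>PiE {1..n} narrow. fact (n * Suc k - 1) * c * (e / Y)
        * (mult_weight {1..n} m * divided_diff (nodes k {1..n} m) ((fdiff ^^ Suc k) (\<lambda>p. x powi p))))"
    proof (rule sum_interlacing[where lam = lam and n = n and k = k, folded l_def, OF lam step(1)])
      fix mu assume mu: "mu \<in> PiE {1..n} (\<lambda>i. {lam (i + 1)..lam i})"
      let ?m = "restrict (shifted k n mu) {1..n}"
      have "nodes k {1..n} (shifted k n mu) = nodes k {1..n} ?m"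
        by (rule nodes_cong) simp
      then have "complex_of_real (jack_psi (real (Suc k)) n lam mu) * (x - 1) ^ Suc k
            * ((x - 1) ^ (n * Suc k - 1) * jack_value k n mu x)
          = fact (n * Suc k - 1) * c * (complex_of_real (jack_psi (real (Suc k)) n lam mu) * pair_prod (falling k) n (shifted k n mu))
             * ((x - 1) ^ Suc k * divided_diff (nodes k {1..n} ?m) (\<lambda>p. x powi p))"
        unfolding IH(2)[OF nonneg[OF mu] x] by (simp only: mult_ac)
      then show "complex_of_real (jack_psi (real (Suc k)) n lam mu) * (x - 1) ^ Suc k
            * ((x - 1) ^ (n * Suc k - 1) * jack_value k n mu x)
          = fact (n * Suc k - 1) * c * (e / Y)
            * (mult_weight {1..n} ?m * divided_diff (nodes k {1..n} ?m) ((fdiff ^^ Suc k) (\<lambda>p. x powi p)))"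
        unfolding weights[OF mu] funpow_fdiff_power[OF x] divided_diff_cmult by (simp only: mult_ac)
    qed
    also have "\<dots> = fact (n * Suc k - 1) * c * (e / Y) * functional (\<lambda>p. x powi p)"
      unfolding functional_def sum_distrib_left[symmetric] ..
    \<comment> \<open>The factorial quotient of \<open>functional_eq_divided_diff\<close> replaces
      \<open>fact (n * Suc k - 1)\<close> by the factorial for \<open>Suc n\<close>.\<close>
    also have "\<dots> = fact (Suc n * Suc k - 1) * (c * e * (total / Y))
        * divided_diff (nodes k {1..Suc n} l) (\<lambda>p. x powi p)"
      unfolding functional_eq_divided_diff[OF step(1)] by (simp del: mult_Suc)
    finally show "(x - 1) ^ (Suc n * Suc k - 1) * jack_value k (Suc n) lam x
        = fact (Suc n * Suc k - 1) * (c * e * c') * pair_prod (falling k) (Suc n) (shifted k (Suc n) lam)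
          * divided_diff (nodes k {1..Suc n} (shifted k (Suc n) lam)) (\<lambda>p. x powi p)"
      unfolding total_Y by (simp add: l_def del: mult_Suc)
  qed
qed

section \<open>Jack characters and the contour integral\<close>

lemma jack_char_divided_diff:
  assumes n: "1 \<le> n" and lam: "lam \<in> signatures n" and x: "x \<noteq> 0" "x \<noteq> 1"
  shows "jack_char (real (Suc k)) n 1 lam (\<lambda>_. x) = fact (Suc k * n - 1) / (x - 1) ^ (Suc k * n - 1)
    * divided_diff (nodes k {1..n} (shifted k n lam)) (\<lambda>p. x powi p)"
proof -
  define K where "K = max 0 (- lam n)"
  define mu where "mu = (\<lambda>i\<in>{1..n}. lam i + K)"
  define S where "S = nodes k {1..n} (shifted k n lam)"
  have mu: "mu \<in> signatures_nonneg n"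
    using lam n by (auto simp: mu_def K_def signatures_nonneg_def signatures_def)
  obtain c where c: "c \<noteq> 0" and
    at_1: "jack_value k n mu 1 = c * pair_prod (falling k) n (shifted k n mu)" and
    at_x: "(x - 1) ^ (n * Suc k - 1) * jack_value k n mu x
        = fact (n * Suc k - 1) * c * pair_prod (falling k) n (shifted k n mu)
          * divided_diff (nodes k {1..n} (shifted k n mu)) (\<lambda>p. x powi p)"
    using jack_value_divided_diff[OF n, of k] mu x by blast
  \<comment> \<open>\<open>l j < l i\<close> lies outside the block at \<open>l i\<close>. Hence the
    denominator of the Jack character is nonzero.\<close>
  have falling_ne: "falling k (shifted k n mu i) (shifted k n mu j) \<noteq> 0"
    if "i \<in> {1..n}" "j \<in> {1..n}" "i < j" for i j
  proof -
    obtain n' where n': "n = Suc n'" using n by (cases n) auto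
    interpret interlacing k n' "shifted k n mu"
      unfolding n' using mu n' by (intro interlacing_shifted) (simp add: signatures_nonneg_def)
    have "shifted k n mu j < shifted k n mu i"
      using decreasing[of i j] that n' by simp
    then show ?thesis by (auto simp: falling_def poly_root_poly block_def)
  qed
  then have J1: "jack_value k n mu 1 \<noteq> 0"
    unfolding at_1 using c by (simp add: pair_prod_def)
  \<comment> \<open>Raising the signature by \<open>K\<close> translates the nodes and multiplies
    the divided difference by \<open>x powi K\<close>; the prefactor in \<open>jack\<close> undoes
    this.\<close>
  have "nodes k {1..n} (shifted k n mu) = (\<lambda>p. p + K) ` S"
  proof -
    have "block k (shifted k n mu i) = (\<lambda>p. p + K) ` block k (shifted k n lam i)" if "i \<in> {1..n}" for i
    proof -
      have "shifted k n mu i = shifted k n lam i + K" using that by (simp add: shifted_def mu_def)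
      then show ?thesis by (simp add: block_def add.assoc add.commute)
    qed
    then show ?thesis unfolding S_def nodes_def by (simp add: image_UN)
  qed
  moreover have "divided_diff ((\<lambda>p. p + K) ` S) (\<lambda>p. x powi p) = divided_diff S (\<lambda>p. x powi (p + K))"
  proof -
    have "(\<Prod>s\<in>(\<lambda>p. p + K) ` S - {p + K}. of_int (p + K - s) :: complex) = (\<Prod>s\<in>S - {p}. of_int (p - s))" for p
      by (rule prod.reindex_bij_witness[of _ "\<lambda>s. s + K" "\<lambda>s. s - K"]) auto
    then show ?thesis unfolding divided_diff_def by (subst sum.reindex) (auto simp: inj_on_def)
  qed
  moreover have "divided_diff S (\<lambda>p. x powi (p + K)) = x powi K * divided_diff S (\<lambda>p. x powi p)"
    using x by (simp add: divided_diff_cmult[symmetric] power_int_add mult.commute)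
  ultimately have "(x - 1) ^ (n * Suc k - 1) * jack_value k n mu x
      = fact (n * Suc k - 1) * jack_value k n mu 1 * (x powi K * divided_diff S (\<lambda>p. x powi p))"
    using at_x unfolding at_1 by simp
  moreover have "(x - 1) ^ (n * Suc k - 1) \<noteq> 0" using x by simp
  ultimately have Jx: "jack_value k n mu x
      = fact (n * Suc k - 1) * jack_value k n mu 1 * (x powi K * divided_diff S (\<lambda>p. x powi p)) / (x - 1) ^ (n * Suc k - 1)"
    by (subst nonzero_eq_divide_eq) (simp_all only: mult.commute not_False_eq_True)
  have numerator: "jack (real (Suc k)) n lam (\<lambda>i. if i \<le> 1 then x else 1) = x powi (- K) * jack_value k n mu x"
  proof -
    have "(\<Prod>i=1..n. if i \<le> 1 then x else 1) = (\<Prod>i=1..n. if i = 1 then x else 1)"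
      by (rule prod.cong) auto
    also have "\<dots> = x" using n by simp
    finally show ?thesis unfolding jack_def Let_def K_def[symmetric] mu_def[symmetric] by (simp only:)
  qed
  have denominator: "jack (real (Suc k)) n lam (\<lambda>_. 1) = jack_value k n mu 1"
    unfolding jack_def Let_def K_def[symmetric] mu_def[symmetric] by simp
  show ?thesis
    unfolding jack_char_def numerator denominator Jx S_def[symmetric] mult.commute[of "Suc k" n] using x J1
    by (simp add: power_int_minus del: mult_Suc mult_Suc_right)
qed

text \<open>Partial fractions of \<open>1 / root_poly S\<close> reduce the integral to Cauchy's
  formula at each node.\<close>

lemma divided_diff_contour_integral:
  assumes S: "finite S" "S \<noteq> {}" and x: "x \<noteq> 0"
    and \<gamma>: "valid_path \<gamma>" "pathfinish \<gamma> = pathstart \<gamma>"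
    and winding: "\<And>s. s \<in> S \<Longrightarrow> of_int s \<notin> path_image \<gamma> \<and> winding_number \<gamma> (of_int s) = 1"
  shows "((\<lambda>z. x powr z / poly (root_poly S) z) has_contour_integral
     (2 * of_real pi * \<i> * divided_diff S (\<lambda>p. x powi p))) \<gamma>"
proof (rule has_contour_integral_eq)
  let ?D = "\<lambda>s. \<Prod>t\<in>S - {s}. of_int (s - t) :: complex"
  have "((\<lambda>z. \<Sum>s\<in>S. x powr z / (z - of_int s) / ?D s) has_contour_integral
     (\<Sum>s\<in>S. 2 * of_real pi * \<i> * winding_number \<gamma> (of_int s) * (x powr of_int s) / ?D s)) \<gamma>"
  proof (intro has_contour_integral_sum has_contour_integral_div S(1))
    fix s assume s: "s \<in> S"
    show "((\<lambda>z. x powr z / (z - of_int s)) has_contour_integral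
        2 * of_real pi * \<i> * winding_number \<gamma> (of_int s) * (x powr of_int s)) \<gamma>"
    proof -
      \<comment> \<open>For fixed nonzero \<open>x\<close> the power is entire in \<open>z\<close>,
        and at integers its value does not depend on the branch. \<open>Ln\<close> has imaginary
        part pi on the negative axis.\<close>
      have "(\<lambda>z. exp (z * Ln x)) holomorphic_on UNIV"
        by (intro holomorphic_intros)
      then have "(\<lambda>z. x powr z) holomorphic_on UNIV" using x by (simp add: powr_def)
      moreover have "path_image \<gamma> \<subseteq> UNIV - {of_int s}" using winding[OF s] by auto
      ultimately show ?thesis
        using Cauchy_integral_formula_convex_simple[of UNIV "\<lambda>z. x powr z" "of_int s" \<gamma>] \<gamma> by simp
    qed
  qed
  also have "(\<Sum>s\<in>S. 2 * of_real pi * \<i> * winding_number \<gamma> (of_int s) * (x powr of_int s) / ?D s)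
      = 2 * of_real pi * \<i> * divided_diff S (\<lambda>p. x powi p)"
    using winding x by (simp add: divided_diff_def sum_distrib_left complex_powr_of_int mult.assoc)
  finally show "((\<lambda>z. \<Sum>s\<in>S. x powr z / (z - of_int s) / ?D s) has_contour_integral
      (2 * of_real pi * \<i> * divided_diff S (\<lambda>p. x powi p))) \<gamma>" .
  fix z assume z: "z \<in> path_image \<gamma>"
  then have z: "z \<notin> of_int ` S" using winding by auto
  have deg: "degree (1 :: complex poly) < card S + 0" using S by (simp add: card_gt_0_iff)
  have "1 / poly (root_poly S) z = divided_diff S (\<lambda>s. 1 / (z - of_int s))"
  proof (rule partial_fractions[OF S(1) deg])
    fix E :: "complex poly"
    assume E: "E = 0 \<or> degree E < 0" and "\<And>z. z \<notin> of_int ` S \<Longrightarrow> poly 1 z / poly (root_poly S) z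
          = poly E z + divided_diff S (\<lambda>s. poly 1 (of_int s) / (z - of_int s))"
    from this(2)[OF z] E show ?thesis by simp
  qed
  then have "x powr z / poly (root_poly S) z = x powr z * divided_diff S (\<lambda>s. 1 / (z - of_int s))"
    by (simp add: divide_inverse)
  then show "(\<Sum>s\<in>S. x powr z / (z - of_int s) / ?D s) = x powr z / poly (root_poly S) z"
    by (simp add: divided_diff_def sum_distrib_left)
qed

lemma pole_prod:
  assumes "1 \<le> n" and lam: "lam \<in> signatures n"
  shows "(\<Prod>i=1..n. \<Prod>j\<in>{0..<Suc k}. z - jack_pole (Suc k) n lam i j)
    = poly (root_poly (nodes k {1..n} (shifted k n lam))) z"
proof -
  obtain n' where n': "n = Suc n'" using assms by (cases n) auto
  interpret interlacing k n' "shifted k n lam"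
    using lam unfolding n' by (rule interlacing_shifted)
  have "poly (root_poly (nodes k {1..n} (shifted k n lam))) z
      = (\<Prod>i\<in>{1..n}. \<Prod>s\<in>block k (shifted k n lam i). z - of_int s)"
    unfolding poly_root_poly nodes_def using block_l_disjoint unfolding n'
    by (intro prod.UNION_disjoint) auto
  also have "\<dots> = (\<Prod>i=1..n. \<Prod>j\<in>{0..<Suc k}. z - jack_pole (Suc k) n lam i j)"
  proof (rule prod.cong[OF refl])
    fix i assume "i \<in> {1..n}"
    show "(\<Prod>s\<in>block k (shifted k n lam i). z - of_int s) = (\<Prod>j\<in>{0..<Suc k}. z - jack_pole (Suc k) n lam i j)"
      by (rule prod.reindex_bij_witness[of _ "\<lambda>j. shifted k n lam i + int j" "\<lambda>s. nat (s - shifted k n lam i)"])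
         (auto simp: block_def jack_pole_def shifted_def)
  qed
  finally show ?thesis ..
qed

text \<open>The positively oriented contour around the poles is any closed valid path that avoids
  them and has winding number 1 about each.\<close>

theorem theorem2p5:
  fixes \<theta> N :: nat and lam :: "nat \<Rightarrow> int" and x :: complex and \<gamma> :: "real \<Rightarrow> complex"
  assumes "1 \<le> \<theta>" and "1 \<le> N" and "lam \<in> signatures N" and "x \<noteq> 0" and "x \<noteq> 1"
    and "valid_path \<gamma>" and "pathfinish \<gamma> = pathstart \<gamma>"
    and "\<And>i j. i \<in> {1..N} \<Longrightarrow> j \<in> {0..<\<theta>} \<Longrightarrow>
           jack_pole \<theta> N lam i j \<notin> path_image \<gamma> \<and> winding_number \<gamma> (jack_pole \<theta> N lam i j) = 1"
  shows "jack_char (real \<theta>) N 1 lam (\<lambda>_. x) =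
           fact (\<theta> * N - 1) / (x - 1) ^ (\<theta> * N - 1)
           * (1 / (2 * of_real pi * \<i>)
              * contour_integral \<gamma>
                  (\<lambda>z. x powr z / (\<Prod>i=1..N. \<Prod>j\<in>{0..<\<theta>}. z - jack_pole \<theta> N lam i j)))"
proof -
  obtain k where k: "\<theta> = Suc k" using assms(1) by (cases \<theta>) auto
  define S where "S = nodes k {1..N} (shifted k N lam)"
  have S: "finite S" by (simp add: S_def)
  have "shifted k N lam 1 \<in> S"
    using assms(2) by (auto simp: S_def nodes_def block_def intro!: bexI[of _ 1])
  then have ne: "S \<noteq> {}" by auto
  have winding: "of_int s \<notin> path_image \<gamma> \<and> winding_number \<gamma> (of_int s) = 1" if s: "s \<in> S" for s
  proof -
    obtain i where i: "i \<in> {1..N}" "s \<in> block k (shifted k N lam i)"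
      using s by (auto simp: S_def nodes_def)
    define j where "j = nat (s - shifted k N lam i)"
    have j: "j \<in> {0..<\<theta>}" and "int j = s - shifted k N lam i"
      using i(2) by (auto simp: j_def block_def k)
    then have "(of_int s :: complex) = jack_pole \<theta> N lam i j"
      by (simp add: jack_pole_def shifted_def k)
    then show ?thesis using assms(8)[OF i(1) j] by simp
  qed
  have "contour_integral \<gamma> (\<lambda>z. x powr z / (\<Prod>i=1..N. \<Prod>j\<in>{0..<\<theta>}. z - jack_pole \<theta> N lam i j))
      = 2 * of_real pi * \<i> * divided_diff S (\<lambda>p. x powi p)"
    unfolding k pole_prod[OF assms(2,3)] S_def[symmetric]
    by (rule contour_integral_unique)
       (rule divided_diff_contour_integral[OF S ne assms(4,6,7) winding])
  then show ?thesis
    unfolding k jack_char_divided_diff[OF assms(2-5)] S_def by simp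
qed

end
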